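(* Consider the scalar-threshold scoring-rule setting with threshold range $[\tau_{\min},\tau_{\max}]$, $Q=\tau_{\max}-\tau_{\min}>0$, target $\phi\in(0,1)$, and costs $C(x,\tau)\in[0,C_{\max}]$ with $C_{\max}\ge1$. For every horizon $T\ge 2$ there is a policy (depending on $T,\phi,\tau_{\min},\tau_{\max},C_{\max}$ but not on the context sequence or its distribution) which chooses its thresholds from a grid on $[\tau_{\min},\tau_{\max}]$ of width $\delta=T^{-1/3}$ (containing both endpoints, with $n=O(Q/\delta)+O(1)$ points), uses only bandit feedback, and satisfies both of the following. (i) Pathwise validity: for every sequence of contexts $x_1,\dots,x_T\in\mathcal X$ and all integers $\ell$, $L\ge1$ with $[\ell,\ell+L-1]\subseteq[n-1,T]$, writing $Y_t=Y(x_t,\tau_t)$, $\Lambda=\frac{C_{\max}}{1-\phi}$ and $\eta=1/\sqrt T$, $$\left|\frac1L\sum_{t=\ell}^{\ell+L-1}Y_t-\phi\right|\le\frac{\Lambda+2\eta}{\eta L}.$$ (ii) Stochastic efficiency: if the contexts $x_t$ are drawn i.i.d. from an unknown distribution $\mathcal D$ on $\mathcal X$ for which $c(\tau)=\mathbb E_{x\sim\mathcal D}[C(x,\tau)]$ is Lipschitz on $[\tau_{\min},\tau_{\max}]$ with constant $c_0=O(1)$, then $$\mathbb E\left[\sum_{t=1}^T\left(C(x_t,\tau_t)-C^*\right)\right]=\widetilde O\!\left(T^{2/3}\right),$$ where the $\widetilde O$ hides factors polylogarithmic in $T$ and constants depending only on $Q,\phi,C_{\max},c_0$.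
   Context: Scalar-threshold scoring-rule setting. There is a context space $\mathcal X$, a success indicator $Y(x,\tau)\in\{0,1\}$ and a cost $C(x,\tau)\in[0,C_{\max}]$ for $x\in\mathcal X$, $\tau\in[\tau_{\min},\tau_{\max}]$. For each $x$ there is $\tau_x\in(\tau_{\min},\tau_{\max})$ with $Y(x,\tau)=0$ for $\tau<\tau_x$ and $Y(x,\tau)=1$ for $\tau\ge\tau_x$; and $\tau\mapsto C(x,\tau)$ is non-decreasing. The boundary thresholds satisfy $C(x,\tau_{\min})=0$ and $C(x,\tau_{\max})=C_{\max}$ for all $x$. At each step $t=1,\dots,T$ the policy chooses $\tau_t\in[\tau_{\min},\tau_{\max}]$ without seeing $x_t$, and then observes only $Y(x_t,\tau_t)$ and $C(x_t,\tau_t)$ (bandit feedback); $\tau_t$ may depend only on past observations (and internal randomness). Benchmark. With $r(\tau)=\mathbb E_{x\sim\mathcal D}[Y(x,\tau)]$, $C^*$ is the optimal expected per-step cost of a stochastic policy satisfying validity in expectation: $C^*=\inf_\nu\int c(\tau)\,d\nu(\tau)$ over all probability distributions $\nu$ on $[\tau_{\min},\tau_{\max}]$ with $\int r(\tau)\,d\nu(\tau)\ge\phi$. *)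

theory Defs
  imports "HOL-Probability.Probability"
begin

definition scalar_threshold_setting ::
  "'x set \<Rightarrow> ('x \<Rightarrow> real \<Rightarrow> real) \<Rightarrow> ('x \<Rightarrow> real \<Rightarrow> real) \<Rightarrow> real \<Rightarrow> real \<Rightarrow> real \<Rightarrow> bool"
  where
  "scalar_threshold_setting X Y C \<tau>min \<tau>max Cmax \<longleftrightarrow>
     (\<forall>x\<in>X.
        (\<exists>\<tau>x\<in>{\<tau>min<..<\<tau>max}. \<forall>\<tau>\<in>{\<tau>min..\<tau>max}.
            (\<tau> < \<tau>x \<longrightarrow> Y x \<tau> = 0) \<and> (\<tau>x \<le> \<tau> \<longrightarrow> Y x \<tau> = 1)) \<and>
        (\<forall>\<tau>\<in>{\<tau>min..\<tau>max}. C x \<tau> \<in> {0..Cmax}) \<and>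
        mono_on {\<tau>min..\<tau>max} (C x) \<and>
        C x \<tau>min = 0 \<and> C x \<tau>max = Cmax)"

text \<open>If the spacing \<open>\<delta>\<close> does not divide the length of the interval, the last gap is
  shorter than \<open>\<delta>\<close>.\<close>

definition threshold_grid :: "real \<Rightarrow> real \<Rightarrow> real \<Rightarrow> real set" where
  "threshold_grid \<tau>min \<tau>max \<delta> =
     ({\<tau>min..\<tau>max} \<inter> range (\<lambda>k::nat. \<tau>min + real k * \<delta>)) \<union> {\<tau>max}"

text \<open>A policy is a pair of a law \<open>R\<close> of a random seed (all internal randomness) and a map
  \<open>\<alpha>\<close> giving the next threshold from the seed and the list of past observations
  \<open>(Y, C)\<close>, oldest first. Past thresholds need not be listed, since the seed and the earlier
  observations determine them. The length of the list determines the current step.\<close>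

definition bandit_policy ::
  "real measure \<Rightarrow> (real \<Rightarrow> (real \<times> real) list \<Rightarrow> real) \<Rightarrow> bool" where
  "bandit_policy R \<alpha> \<longleftrightarrow>
     prob_space R \<and>
     (\<forall>m. (\<lambda>(\<omega>, h). \<alpha> \<omega> (map h [0..<m]))
            \<in> borel_measurable (R \<Otimes>\<^sub>M (\<Pi>\<^sub>M i\<in>{..<m}. borel \<Otimes>\<^sub>M borel)))"

text \<open>The observations of steps \<open>1, \<dots>, t\<close> when the decision rule \<open>a\<close>
  (a policy with its seed fixed) faces the contexts \<open>x 1, x 2, \<dots>\<close>.\<close>

primrec observations ::
  "((real \<times> real) list \<Rightarrow> real) \<Rightarrow> ('x \<Rightarrow> real \<Rightarrow> real) \<Rightarrow> ('x \<Rightarrow> real \<Rightarrow> real) \<Rightarrow>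
     (nat \<Rightarrow> 'x) \<Rightarrow> nat \<Rightarrow> (real \<times> real) list" where
  "observations a Y C x 0 = []"
| "observations a Y C x (Suc t) =
     (let h = observations a Y C x t; \<tau> = a h
      in h @ [(Y (x (Suc t)) \<tau>, C (x (Suc t)) \<tau>)])"

definition chosen_threshold ::
  "((real \<times> real) list \<Rightarrow> real) \<Rightarrow> ('x \<Rightarrow> real \<Rightarrow> real) \<Rightarrow> ('x \<Rightarrow> real \<Rightarrow> real) \<Rightarrow>
     (nat \<Rightarrow> 'x) \<Rightarrow> nat \<Rightarrow> real" where
  "chosen_threshold a Y C x t = a (observations a Y C x (t - 1))"

text \<open>\<open>mean_value D Y\<close> is \<open>r\<close> and \<open>mean_value D C\<close> is \<open>c\<close>.\<close>

definition mean_value :: "'x measure \<Rightarrow> ('x \<Rightarrow> real \<Rightarrow> real) \<Rightarrow> real \<Rightarrow> real" where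
  "mean_value D f \<tau> = (\<integral>x. f x \<tau> \<partial>D)"

definition optimal_cost ::
  "'x measure \<Rightarrow> ('x \<Rightarrow> real \<Rightarrow> real) \<Rightarrow> ('x \<Rightarrow> real \<Rightarrow> real) \<Rightarrow> real \<Rightarrow> real \<Rightarrow> real \<Rightarrow> real" where
  "optimal_cost D Y C \<tau>min \<tau>max \<phi> =
     Inf {(\<integral>\<tau>. mean_value D C \<tau> \<partial>\<nu>) | \<nu>.
            prob_space \<nu> \<and> sets \<nu> = sets (restrict_space borel {\<tau>min..\<tau>max}) \<and>
            (\<integral>\<tau>. mean_value D Y \<tau> \<partial>\<nu>) \<ge> \<phi>}"

end

theory Submission
  imports Defs
begin

text \<open>
  The policy is a deterministic primal-dual algorithm. The multiplier
  \<open>\<lambda>\<^sub>t = \<eta> (\<Sum>s<t. \<phi> - Y\<^sub>s)\<close> measures the validity deficit. Forcing \<open>\<tau>min\<close> when \<open>\<lambda>\<^sub>t < 0\<close> and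
  \<open>\<tau>max\<close> when \<open>\<lambda>\<^sub>t > \<Lambda>\<close> keeps it in \<open>[-\<eta>, \<Lambda> + \<eta>]\<close>, which is pathwise validity. By the choice of
  \<open>\<Lambda>\<close>, the Lagrangian cost \<open>C\<^sub>t + \<lambda>\<^sub>t (\<phi> - Y\<^sub>t)\<close> of a forced step is at most \<open>0 \<le> C\<^sup>*\<close>. In every other
  step the policy minimises over the grid a lower confidence bound of the Lagrangian cost, so no
  randomisation is needed. The confidence radius \<open>\<beta> / (N + 1) + \<theta> B\<^sup>2 / 2\<close> with the fixed scale
  \<open>\<theta> = T powr (-1/3)\<close> comes from the supermartingale
  \<open>exp (\<theta> M - \<theta>\<^sup>2 B\<^sup>2 N / 2)\<close>: using \<open>ln u \<le> ln T + u / T\<close>, the amount by which the bound fails is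
  controlled in expectation, and no union bound is needed. The radii add up to a harmonic sum for
  each grid point, and \<open>\<Sum> \<lambda>\<^sub>t (\<phi> - Y\<^sub>t) \<ge> - \<eta> T / 2\<close> by telescoping \<open>\<lambda>\<^sub>t\<^sup>2\<close>.
\<close>

section \<open>The policy\<close>

text \<open>\<open>arg_min_on\<close> is a Hilbert choice, but it depends on \<open>w\<close> only
  through the set of minimisers. That set takes finitely many values, and any selection defined on a
  discrete space is measurable.\<close>

lemma measurable_arg_min_on:
  fixes f :: "'a \<Rightarrow> 'b \<Rightarrow> real"
  assumes "finite S" "S \<noteq> {}" and f: "\<And>g. g \<in> S \<Longrightarrow> (\<lambda>w. f w g) \<in> borel_measurable M"
  shows "(\<lambda>w. arg_min_on (f w) S) \<in> M \<rightarrow>\<^sub>M count_space S"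
proof -
  define minimisers where "minimisers w = {g \<in> S. \<forall>g'\<in>S. f w g \<le> f w g'}" for w
  have "minimisers \<in> M \<rightarrow>\<^sub>M count_space (Pow S)"
  proof (subst measurable_count_space_eq2)
    show "finite (Pow S)" using assms by simp
    have "minimisers -` {E} \<inter> space M \<in> sets M" if "E \<subseteq> S" for E
    proof -
      have "minimisers w = E \<longleftrightarrow> (\<forall>g\<in>S. g \<in> E \<longleftrightarrow> (\<forall>g'\<in>S. f w g \<le> f w g'))" for w
        using that unfolding minimisers_def by blast
      then have "minimisers -` {E} \<inter> space M =
          {w \<in> space M. \<forall>g\<in>S. g \<in> E \<longleftrightarrow> (\<forall>g'\<in>S. f w g \<le> f w g')}"
        by (simp add: vimage_def Int_def conj_commute)
      also have "\<dots> \<in> sets M"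
      proof (rule sets.sets_Collect_finite_All'[OF _ \<open>finite S\<close> \<open>S \<noteq> {}\<close>])
        fix g assume "g \<in> S"
        have "{w \<in> space M. \<forall>g'\<in>S. f w g \<le> f w g'} \<in> sets M"
          by (rule sets.sets_Collect_finite_All'[OF _ \<open>finite S\<close> \<open>S \<noteq> {}\<close>])
             (intro borel_measurable_le f \<open>g \<in> S\<close>)
        from this sets.sets_Collect_neg[OF this]
        show "{w \<in> space M. g \<in> E \<longleftrightarrow> (\<forall>g'\<in>S. f w g \<le> f w g')} \<in> sets M"
          by (cases "g \<in> E") (simp_all only: simp_thms)
      qed
      finally show ?thesis .
    qed
    then show "minimisers \<in> space M \<rightarrow> Pow S \<and>
        (\<forall>E\<in>Pow S. minimisers -` {E} \<inter> space M \<in> sets M)"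
      by (auto simp: minimisers_def)
  qed
  \<comment> \<open>The minimiser set is never empty; the branch for \<open>E = {}\<close> only
    makes the selection land in \<open>S\<close> on all of \<open>Pow S\<close>.\<close>
  moreover have "(\<lambda>E. if E = {} then (SOME g. g \<in> S) else (SOME g. g \<in> E)) \<in>
      count_space (Pow S) \<rightarrow>\<^sub>M count_space S"
    unfolding measurable_count_space_eq1 space_count_space
  proof (rule Pi_I)
    fix E assume "E \<in> Pow S"
    then show "(if E = {} then (SOME g. g \<in> S) else (SOME g. g \<in> E)) \<in> S"
      using assms(2) some_in_eq[of S] some_in_eq[of E] by (cases "E = {}") auto
  qed
  ultimately have "(\<lambda>w. if minimisers w = {} then (SOME g. g \<in> S) else (SOME g. g \<in> minimisers w))
      \<in> M \<rightarrow>\<^sub>M count_space S"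
    by (rule measurable_compose)
  moreover have "arg_min_on (f w) S =
      (if minimisers w = {} then (SOME g. g \<in> S) else (SOME g. g \<in> minimisers w))" for w
  proof -
    have "arg_min_on (f w) S \<in> minimisers w"
      using arg_min_if_finite(1)[OF assms(1,2)] arg_min_least[OF assms(1,2)]
      unfolding minimisers_def by blast
    moreover have "arg_min_on (f w) S = (SOME g. g \<in> minimisers w)"
      by (simp only: arg_min_on_def arg_min_def is_arg_min_linorder minimisers_def mem_Collect_eq
          Ball_def)
    ultimately show ?thesis by (metis empty_iff)
  qed
  ultimately show ?thesis by (simp only:)
qed

section \<open>The index policy and its measurability\<close>

locale primal_dual_lcb =
  fixes G :: "real set" and lo hi \<phi> \<eta> \<Lambda> \<beta> :: real
  assumes finite_G: "finite G" and lo_in_G: "lo \<in> G" and hi_in_G: "hi \<in> G"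
begin

definition multiplier :: "(real \<times> real) list \<Rightarrow> real" where
  "multiplier h = (\<Sum>i<length h. \<eta> * (\<phi> - fst (h ! i)))"

text \<open>The part \<open>\<theta> B\<^sup>2 / 2\<close> of the confidence radius is the same for all grid points, so the
  index leaves it out. The denominator \<open>N + 1\<close> makes an initial round of exploration
  unnecessary.\<close>

function policy :: "(real \<times> real) list \<Rightarrow> real" where
  "policy h =
     (if multiplier h < 0 then lo
      else if multiplier h > \<Lambda> then hi
      else arg_min_on (\<lambda>g.
        ((\<Sum>i<length h. of_bool (policy (take i h) = g) * snd (h ! i))
          - multiplier h * (\<Sum>i<length h. of_bool (policy (take i h) = g) * fst (h ! i))
          - (1 + multiplier h) * \<beta>)
        / ((\<Sum>i<length h. of_bool (policy (take i h) = g)) + 1)) G)"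
  by pat_completeness auto
text \<open>The history does not list past thresholds, so the policy recomputes them from the
  prefixes \<open>take i h\<close>. These are shorter because the sums range over
  \<open>i < length h\<close>.\<close>

termination by (relation "Wellfounded.measure length") auto

declare policy.simps [simp del]

lemma G_nonempty: "G \<noteq> {}"
  using lo_in_G by auto

lemma policy_in_G: "policy h \<in> G"
  using lo_in_G hi_in_G
  by (subst policy.simps) (simp add: arg_min_if_finite(1)[OF finite_G G_nonempty])

text \<open>Strong induction on the history length: if the earlier thresholds are measurable, so are
  the index of each grid point and the minimiser. The observations are arbitrary measurable maps, so
  that the lemma covers both the coordinates of a product space and the history produced by random
  contexts.\<close>

lemma measurable_policy:
  assumes "\<And>i. i < m \<Longrightarrow> ob i \<in> M \<rightarrow>\<^sub>M borel \<Otimes>\<^sub>M borel"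
  shows "(\<lambda>w. policy (map (\<lambda>i. ob i w) [0..<m])) \<in> M \<rightarrow>\<^sub>M count_space G"
  using assms
proof (induction m rule: less_induct)
  case (less m)
  have ob[measurable]: "(\<lambda>w. fst (ob i w)) \<in> borel_measurable M"
    "(\<lambda>w. snd (ob i w)) \<in> borel_measurable M" if "i < m" for i
    by (rule measurable_compose[OF less.prems[OF that]], simp)+
  define a where "a i w = policy (map (\<lambda>i. ob i w) [0..<i])" for i w
  have a[measurable]: "a i \<in> M \<rightarrow>\<^sub>M count_space G" if "i < m" for i
    unfolding a_def using that by (intro less.IH less.prems) auto
  have hit[measurable]: "(\<lambda>w. of_bool (a i w = g) :: real) \<in> borel_measurable M"
    if "i < m" "g \<in> G" for i g
    by (rule measurable_compose[OF a[OF that(1)]]) simp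
  define lam where "lam w = (\<Sum>i<m. \<eta> * (\<phi> - fst (ob i w)))" for w
  have [measurable]: "lam \<in> borel_measurable M"
    unfolding lam_def
    by (intro borel_measurable_sum borel_measurable_times borel_measurable_diff ob) auto
  define idx where "idx w g =
      ((\<Sum>i<m. of_bool (a i w = g) * snd (ob i w))
          - lam w * (\<Sum>i<m. of_bool (a i w = g) * fst (ob i w)) - (1 + lam w) * \<beta>)
        / ((\<Sum>i<m. of_bool (a i w = g)) + 1)" for w g
  have idx: "(\<lambda>w. idx w g) \<in> borel_measurable M" if "g \<in> G" for g
    unfolding idx_def using that
    by (intro borel_measurable_divide borel_measurable_diff borel_measurable_add
        borel_measurable_sum borel_measurable_times borel_measurable_const hit ob \<open>lam \<in> borel_measurable M\<close>) auto
  have [measurable]: "(\<lambda>w. arg_min_on (idx w) G) \<in> M \<rightarrow>\<^sub>M count_space G"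
    by (rule measurable_arg_min_on[OF finite_G G_nonempty idx])
  have "policy (map (\<lambda>i. ob i w) [0..<m]) =
      (if lam w < 0 then lo else if lam w > \<Lambda> then hi else arg_min_on (idx w) G)" for w
  proof -
    define h where "h = map (\<lambda>i. ob i w) [0..<m]"
    have h: "length h = m" "\<And>i. i < m \<Longrightarrow> h ! i = ob i w"
        "\<And>i. i < m \<Longrightarrow> policy (take i h) = a i w"
      by (simp_all add: h_def a_def take_map)
    have "multiplier h = lam w"
      unfolding multiplier_def lam_def by (rule sum.cong) (simp_all add: h)
    moreover have "((\<Sum>i<length h. of_bool (policy (take i h) = g) * snd (h ! i))
          - lam w * (\<Sum>i<length h. of_bool (policy (take i h) = g) * fst (h ! i))
          - (1 + lam w) * \<beta>)
        / ((\<Sum>i<length h. of_bool (policy (take i h) = g)) + 1) = idx w g" for g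
      unfolding idx_def
      by (intro arg_cong2[of _ _ _ _ "(/)"] arg_cong2[of _ _ _ _ "(-)"]
          arg_cong2[of _ _ _ _ "(+)"] arg_cong2[of _ _ _ _ "(*)"] sum.cong refl)
        (simp_all add: h)
    ultimately show ?thesis
      unfolding h_def[symmetric] by (subst policy.simps) (simp only:)
  qed
  moreover have "(\<lambda>w. if lam w < 0 then lo else if lam w > \<Lambda> then hi else arg_min_on (idx w) G)
      \<in> M \<rightarrow>\<^sub>M count_space G"
    by (intro measurable_If measurable_const borel_measurable_less borel_measurable_const)
       (use lo_in_G hi_in_G in \<open>simp_all\<close>)
  ultimately show ?case by (simp only:)
qed

text \<open>The algorithm is deterministic, so the seed is a point mass and is ignored.\<close>

lemma bandit_policy: "bandit_policy (return borel 0) (\<lambda>_. policy)"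
  unfolding bandit_policy_def
proof (intro conjI allI)
  show "prob_space (return borel (0::real))"
    by (rule prob_space_return) simp
  fix m :: nat
  let ?M = "return borel (0::real) \<Otimes>\<^sub>M (\<Pi>\<^sub>M i\<in>{..<m}. borel \<Otimes>\<^sub>M borel)"
  have "(\<lambda>w. snd w i) \<in> ?M \<rightarrow>\<^sub>M borel \<Otimes>\<^sub>M borel" if "i < m" for i
    by (rule measurable_compose[OF measurable_snd measurable_component_singleton]) (use that in simp)
  then have "(\<lambda>w. policy (map (\<lambda>i. snd w i) [0..<m])) \<in> ?M \<rightarrow>\<^sub>M count_space G"
    by (rule measurable_policy)
  then have "(\<lambda>w. policy (map (\<lambda>i. snd w i) [0..<m])) \<in> borel_measurable ?M"
    by (rule measurable_compose[where g = "\<lambda>g. g"]) simp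
  moreover have "(\<lambda>(\<omega>, h). policy (map h [0..<m])) =
      (\<lambda>w :: real \<times> _. policy (map (\<lambda>i. snd w i) [0..<m]))"
    by (simp add: fun_eq_iff)
  ultimately show "(\<lambda>(\<omega>, h). policy (map h [0..<m])) \<in> borel_measurable ?M"
    by (simp only:)
qed

end

section \<open>Pathwise analysis\<close>

text \<open>\<open>B\<close> stands for the cost cap. The endpoint values make the forced moves
  work: \<open>lo\<close> raises the multiplier at cost zero, and \<open>hi\<close> lowers it at a
  cost of at most \<open>B = \<Lambda> * (1 - \<phi>)\<close>.\<close>

locale lcb_environment = primal_dual_lcb G lo hi \<phi> \<eta> \<Lambda> \<beta>
  for G :: "real set" and lo hi \<phi> \<eta> \<Lambda> \<beta> :: real +
  fixes X :: "'x set" and Y C :: "'x \<Rightarrow> real \<Rightarrow> real" and B :: real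
  assumes \<phi>: "0 < \<phi>" "\<phi> < 1" and \<eta>: "0 < \<eta>" and B: "1 \<le> B" and \<Lambda>: "\<Lambda> = B / (1 - \<phi>)"
    and Y_range: "\<And>x g. x \<in> X \<Longrightarrow> g \<in> G \<Longrightarrow> 0 \<le> Y x g \<and> Y x g \<le> 1"
    and C_range: "\<And>x g. x \<in> X \<Longrightarrow> g \<in> G \<Longrightarrow> 0 \<le> C x g \<and> C x g \<le> B"
    and Y_lo: "\<And>x. x \<in> X \<Longrightarrow> Y x lo = 0" and Y_hi: "\<And>x. x \<in> X \<Longrightarrow> Y x hi = 1"
    and C_lo: "\<And>x. x \<in> X \<Longrightarrow> C x lo = 0"
begin

lemma \<Lambda>_nonneg: "0 \<le> \<Lambda>"
  using \<phi> B by (simp add: \<Lambda>)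

text \<open>Time is counted from zero: \<open>arm x t\<close> is the threshold of step
  \<open>Suc t\<close>, chosen after \<open>t\<close> observations, and it meets the context
  \<open>x (Suc t)\<close>.\<close>

definition arm :: "(nat \<Rightarrow> 'x) \<Rightarrow> nat \<Rightarrow> real" where
  "arm x t = policy (observations policy Y C x t)"

definition lam :: "(nat \<Rightarrow> 'x) \<Rightarrow> nat \<Rightarrow> real" where
  "lam x t = (\<Sum>i<t. \<eta> * (\<phi> - Y (x (Suc i)) (arm x i)))"

definition plays :: "(nat \<Rightarrow> 'x) \<Rightarrow> nat \<Rightarrow> real \<Rightarrow> nat" where
  "plays x t g = (\<Sum>i<t. of_bool (arm x i = g))"

definition total :: "('x \<Rightarrow> real \<Rightarrow> real) \<Rightarrow> (nat \<Rightarrow> 'x) \<Rightarrow> nat \<Rightarrow> real \<Rightarrow> real" where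
  "total f x t g = (\<Sum>i<t. of_bool (arm x i = g) * f (x (Suc i)) g)"

text \<open>A lower confidence bound for cost minus multiplier times success. The factor
  \<open>1 + lam x t\<close> pays for the estimation error of the cost and for
  \<open>lam x t\<close> times that of the success rate. The term \<open>lam x t * \<phi>\<close> is
  common to all grid points and does not affect the minimiser.\<close>

definition index :: "(nat \<Rightarrow> 'x) \<Rightarrow> nat \<Rightarrow> real \<Rightarrow> real" where
  "index x t g = (total C x t g - lam x t * total Y x t g - (1 + lam x t) * \<beta>)
    / (real (plays x t g) + 1)"

lemma chosen_threshold_eq: "chosen_threshold policy Y C x (Suc t) = arm x t"
  by (simp add: chosen_threshold_def arm_def)

lemma arm_in_G: "arm x t \<in> G"
  by (simp add: arm_def policy_in_G)

lemma observations_eq: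
  "observations policy Y C x t =
     map (\<lambda>i. (Y (x (Suc i)) (arm x i), C (x (Suc i)) (arm x i))) [0..<t]"
  by (induction t) (simp_all add: arm_def Let_def)

lemma lam_0: "lam x 0 = 0"
  by (simp add: lam_def)

lemma lam_Suc: "lam x (Suc t) = lam x t + \<eta> * (\<phi> - Y (x (Suc t)) (arm x t))"
  by (simp add: lam_def)

text \<open>The past that the policy recomputes agrees with the actual play, since the first
  \<open>i\<close> observations are exactly the history at time \<open>i\<close>.\<close>

lemma arm_unfold:
  "arm x t = (if lam x t < 0 then lo else if \<Lambda> < lam x t then hi else arg_min_on (index x t) G)"
proof -
  define h where "h = observations policy Y C x t"
  have h: "length h = t"
      "\<And>i. i < t \<Longrightarrow> h ! i = (Y (x (Suc i)) (arm x i), C (x (Suc i)) (arm x i))"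
      "\<And>i. i < t \<Longrightarrow> policy (take i h) = arm x i"
  proof -
    show "policy (take i h) = arm x i" if "i < t" for i
    proof -
      have "take i h = observations policy Y C x i"
        using that by (simp add: h_def observations_eq take_map)
      then show ?thesis by (simp only: arm_def)
    qed
  qed (simp_all add: h_def observations_eq)
  have "multiplier h = lam x t"
    unfolding multiplier_def lam_def by (rule sum.cong) (simp_all add: h)
  moreover have "(\<Sum>i<length h. of_bool (policy (take i h) = g) * snd (h ! i)) = total C x t g"
      "(\<Sum>i<length h. of_bool (policy (take i h) = g) * fst (h ! i)) = total Y x t g"
      "(\<Sum>i<length h. of_bool (policy (take i h) = g)) = real (plays x t g)" for g
    unfolding total_def plays_def of_nat_sum h(1)
    by (rule sum.cong; simp add: h(2,3) of_bool_def)+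
  ultimately show ?thesis
    unfolding arm_def[of x t] h_def[symmetric] by (subst policy.simps) (simp only: index_def[abs_def])
qed

lemma index_arm_le:
  assumes "0 \<le> lam x t" "lam x t \<le> \<Lambda>" "g \<in> G"
  shows "index x t (arm x t) \<le> index x t g"
  using arg_min_least[OF finite_G G_nonempty assms(3), of "index x t"] assms(1,2)
  by (simp add: arm_unfold)

text \<open>One step moves the multiplier by at most \<open>\<eta>\<close>, and outside
  \<open>[0, \<Lambda>]\<close> the forced endpoint moves it back, so it overshoots by at most one
  step.\<close>

lemma lam_bounds:
  assumes "\<And>i. i < t \<Longrightarrow> x (Suc i) \<in> X"
  shows "- \<eta> \<le> lam x t \<and> lam x t \<le> \<Lambda> + \<eta>"
  using assms
proof (induction t)
  case 0
  then show ?case using \<Lambda>_nonneg \<eta> by (simp add: lam_0)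
next
  case (Suc t)
  then have IH: "- \<eta> \<le> lam x t" "lam x t \<le> \<Lambda> + \<eta>" and x: "x (Suc t) \<in> X"
    by auto
  have step: "- \<eta> \<le> \<eta> * (\<phi> - y) \<and> \<eta> * (\<phi> - y) \<le> \<eta>" if "0 \<le> y" "y \<le> 1" for y
    using that \<phi> \<eta> mult_left_mono[of "-1" "\<phi> - y" \<eta>] mult_left_mono[of "\<phi> - y" 1 \<eta>] by auto
  consider "lam x t < 0" | "\<Lambda> < lam x t" | "0 \<le> lam x t" "lam x t \<le> \<Lambda>"
    by linarith
  then show ?case
  proof cases
    case 1
    then have "lam x (Suc t) = lam x t + \<eta> * \<phi>"
      using x by (simp add: lam_Suc arm_unfold Y_lo)
    moreover have "0 < \<eta> * \<phi>" "\<eta> * \<phi> \<le> \<eta>"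
      using step[of 0] \<phi> \<eta> by simp_all
    ultimately show ?thesis
      using 1 IH \<Lambda>_nonneg by linarith
  next
    case 2
    then have "lam x (Suc t) = lam x t + \<eta> * (\<phi> - 1)"
      using x \<Lambda>_nonneg by (simp add: lam_Suc arm_unfold Y_hi)
    moreover have "\<eta> * (\<phi> - 1) \<le> 0"
      using \<phi> \<eta> by (simp add: mult_nonneg_nonpos)
    ultimately show ?thesis
      using 2 IH step[of 1] \<Lambda>_nonneg by linarith
  next
    case 3
    with step[of "Y (x (Suc t)) (arm x t)"] Y_range[OF x arm_in_G[of x t]] show ?thesis
      unfolding lam_Suc by linarith
  qed
qed

text \<open>The increments of \<open>lam\<close> are \<open>\<eta>\<close> times the validity
  deficit, so the deficit of a window telescopes to a difference of two multipliers. Both lie in an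
  interval of length \<open>\<Lambda> + 2 * \<eta>\<close>.\<close>

lemma window_validity:
  assumes "\<And>t. t \<in> {1..T} \<Longrightarrow> x t \<in> X" and "1 \<le> L" "1 \<le> l" "l + L - 1 \<le> T"
  shows "\<bar>(\<Sum>t=l..l + L - 1. Y (x t) (chosen_threshold policy Y C x t)) / real L - \<phi>\<bar>
     \<le> (\<Lambda> + 2 * \<eta>) / (\<eta> * real L)"
proof -
  define m where "m = l - 1"
  have m: "l = Suc m" "l + L - 1 = m + L"
    using assms by (simp_all add: m_def)
  have "lam x (m + k) - lam x m =
      \<eta> * (real k * \<phi> - (\<Sum>t=Suc m..m + k. Y (x t) (chosen_threshold policy Y C x t)))" for k
    by (induction k) (simp_all add: lam_Suc chosen_threshold_eq algebra_simps)
  from this[of L]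
  have "(\<Sum>t=l..l + L - 1. Y (x t) (chosen_threshold policy Y C x t)) =
      real L * \<phi> + (lam x m - lam x (m + L)) / \<eta>"
    using \<eta> unfolding m by (simp add: field_simps)
  then have "(\<Sum>t=l..l + L - 1. Y (x t) (chosen_threshold policy Y C x t)) / real L - \<phi> =
      (lam x m - lam x (m + L)) / (\<eta> * real L)"
    using \<eta> assms(2) by (simp add: add_divide_distrib)
  moreover have "\<bar>lam x m - lam x (m + L)\<bar> \<le> \<Lambda> + 2 * \<eta>"
  proof -
    have "- \<eta> \<le> lam x s \<and> lam x s \<le> \<Lambda> + \<eta>" if "s \<le> T" for s
      by (rule lam_bounds) (use that in \<open>simp add: assms(1)\<close>)
    from this[of m] this[of "m + L"] show ?thesis
      using assms(4) m by linarith
  qed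
  ultimately show ?thesis
    using \<eta> by (simp add: abs_divide divide_right_mono)
qed

text \<open>The \<open>j\<close>-th play of a grid point contributes \<open>1 / j\<close>; grouping
  the steps by the point played gives one harmonic number per point.\<close>

lemma sum_bonus_eq_harm:
  "(\<Sum>i<t. 1 / (real (plays x i (arm x i)) + 1)) = (\<Sum>g\<in>G. harm (plays x t g))"
proof (induction t)
  case 0
  then show ?case by (simp add: plays_def harm_expand)
next
  case (Suc t)
  have "(\<Sum>g\<in>G. harm (plays x (Suc t) g)) =
      (\<Sum>g\<in>G. harm (plays x t g) + (if arm x t = g then 1 / (real (plays x t g) + 1) else 0 :: real))"
    by (rule sum.cong) (auto simp: plays_def harm_Suc field_simps)
  also have "\<dots> = (\<Sum>g\<in>G. harm (plays x t g)) + 1 / (real (plays x t (arm x t)) + 1)"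
    using finite_G arm_in_G by (simp add: sum.distrib)
  finally show ?case using Suc.IH by simp
qed

lemma sum_bonus_le:
  assumes "1 \<le> t"
  shows "(\<Sum>i<t. 1 / (real (plays x i (arm x i)) + 1)) \<le> real (card G) * (1 + ln (real t))"
proof -
  have "harm (plays x t g) \<le> 1 + ln (real t)" for g
  proof -
    have "plays x t g \<le> (\<Sum>i<t. 1)"
      unfolding plays_def by (rule sum_mono) simp
    then have "harm (plays x t g) \<le> (harm t :: real)"
      by (intro harm_mono) simp
    \<comment> \<open>The sequence \<open>harm n - ln n\<close> is decreasing and starts with the
      value 1 at \<open>n = 1\<close>.\<close>
    also have "\<dots> \<le> 1 + ln (real t)"
      using euler_mascheroni_sequence_decreasing[of 1 t] assms by (simp add: harm_expand)
    finally show ?thesis .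
  qed
  then have "(\<Sum>g\<in>G. harm (plays x t g)) \<le> (\<Sum>g\<in>G. 1 + ln (real t))"
    by (rule sum_mono)
  then show ?thesis
    by (simp add: sum_bonus_eq_harm)
qed

text \<open>This turns Lagrangian costs back into true costs: dropping the penalty terms from a sum
  over \<open>t\<close> steps loses at most \<open>\<eta> * t / 2\<close>.\<close>

lemma sum_lam_drift_ge:
  assumes "\<And>i. i < t \<Longrightarrow> x (Suc i) \<in> X"
  shows "(\<Sum>i<t. lam x i * (\<phi> - Y (x (Suc i)) (arm x i))) \<ge> - (\<eta> * real t / 2)"
proof -
  \<comment> \<open>The claim keeps the potential \<open>lam^2 / (2 * \<eta>)\<close>, which gains
    exactly \<open>lam * d + \<eta> * d^2 / 2\<close> in a step with deficit \<open>d\<close>; this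
    closes the induction.\<close>
  have "(\<Sum>i<t. lam x i * (\<phi> - Y (x (Suc i)) (arm x i))) \<ge>
      (lam x t)\<^sup>2 / (2 * \<eta>) - \<eta> * real t / 2"
    using assms
  proof (induction t)
    case 0
    then show ?case by (simp add: lam_0)
  next
    case (Suc t)
    define d where "d = \<phi> - Y (x (Suc t)) (arm x t)"
    have "d\<^sup>2 \<le> 1"
      using Y_range[OF Suc.prems[of t] arm_in_G, of x t] \<phi>
      by (simp add: abs_square_le_1 d_def abs_le_iff)
    then have "\<eta> * d\<^sup>2 / 2 \<le> \<eta> / 2"
      using \<eta> by simp
    moreover have "(lam x (Suc t))\<^sup>2 / (2 * \<eta>) = (lam x t)\<^sup>2 / (2 * \<eta>) + lam x t * d + \<eta> * d\<^sup>2 / 2"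
      using \<eta> by (simp add: lam_Suc d_def[symmetric] power2_eq_square field_simps)
    moreover have "(\<Sum>i<t. lam x i * (\<phi> - Y (x (Suc i)) (arm x i)))
        \<ge> (lam x t)\<^sup>2 / (2 * \<eta>) - \<eta> * real t / 2"
      using Suc by simp
    moreover have "\<eta> * real (Suc t) / 2 = \<eta> * real t / 2 + \<eta> / 2"
      by (simp add: field_simps)
    ultimately show ?case
      unfolding sum.lessThan_Suc d_def[symmetric] by linarith
  qed
  moreover have "(lam x t)\<^sup>2 / (2 * \<eta>) \<ge> 0"
    using \<eta> by simp
  ultimately show ?thesis by linarith
qed

end

section \<open>Concentration in expectation\<close>

text \<open>A product law is unchanged when one coordinate is overwritten by an independent copy;
  Fubini then integrates the copy first. This plays the role of conditional expectation given the
  other coordinates.\<close>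

lemma integral_PiM_resample:
  fixes F :: "('i \<Rightarrow> 'a) \<Rightarrow> real"
  assumes M: "\<And>i. i \<in> I \<Longrightarrow> prob_space (M i)" and j: "j \<in> I"
    and F: "F \<in> borel_measurable (Pi\<^sub>M I M)"
    and bound: "\<And>x. x \<in> space (Pi\<^sub>M I M) \<Longrightarrow> \<bar>F x\<bar> \<le> K"
  shows "(\<integral>x. F x \<partial>Pi\<^sub>M I M) = (\<integral>x. (\<integral>y. F (x(j := y)) \<partial>M j) \<partial>Pi\<^sub>M I M)"
    and "integrable (Pi\<^sub>M I M) (\<lambda>x. \<integral>y. F (x(j := y)) \<partial>M j)"
proof -
  interpret J: prob_space "M j" using M j by blast
  interpret P: prob_space "Pi\<^sub>M I M" using M by (rule prob_space_PiM)
  interpret JP: pair_prob_space "M j" "Pi\<^sub>M I M" ..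
  let ?upd = "\<lambda>(y, x). x(j := y)"
  \<comment> \<open>The law for adjoining coordinate \<open>j\<close> also describes overwriting it,
    because \<open>j\<close> is already in \<open>I\<close>.\<close>
  have I: "insert j I = I" using j by auto
  have upd: "?upd \<in> M j \<Otimes>\<^sub>M Pi\<^sub>M I M \<rightarrow>\<^sub>M Pi\<^sub>M I M"
    using measurable_fun_upd[of I I j "\<lambda>p. snd p" "M j \<Otimes>\<^sub>M Pi\<^sub>M I M" M "\<lambda>p. fst p"] I j
    by (simp add: case_prod_beta' insert_absorb)
  have "distr (M j \<Otimes>\<^sub>M Pi\<^sub>M I M) (Pi\<^sub>M I M) ?upd = Pi\<^sub>M I M"
    using distr_pair_PiM_eq_PiM[of I M j] M j unfolding I by blast
  then have "(\<integral>x. F x \<partial>Pi\<^sub>M I M) = (\<integral>p. F (?upd p) \<partial>(M j \<Otimes>\<^sub>M Pi\<^sub>M I M))"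
    using integral_distr[OF upd F] by simp
  moreover have "integrable (M j \<Otimes>\<^sub>M Pi\<^sub>M I M) (\<lambda>p. F (?upd p))"
  proof (rule JP.integrable_const_bound[where B = K])
    show "AE p in M j \<Otimes>\<^sub>M Pi\<^sub>M I M. norm (F (?upd p)) \<le> K"
      by (rule AE_I2) (use measurable_space[OF upd] bound in \<open>metis real_norm_def\<close>)
    show "(\<lambda>p. F (?upd p)) \<in> borel_measurable (M j \<Otimes>\<^sub>M Pi\<^sub>M I M)"
      by (rule measurable_compose[OF upd F])
  qed
  then have "integrable (M j \<Otimes>\<^sub>M Pi\<^sub>M I M) (case_prod (\<lambda>y x. F (x(j := y))))"
    by (simp add: case_prod_beta')
  note JP.integral_snd[OF this] JP.integrable_snd[OF this]
  ultimately show "(\<integral>x. F x \<partial>Pi\<^sub>M I M) = (\<integral>x. (\<integral>y. F (x(j := y)) \<partial>M j) \<partial>Pi\<^sub>M I M)"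
    and "integrable (Pi\<^sub>M I M) (\<lambda>x. \<integral>y. F (x(j := y)) \<partial>M j)"
    by (simp_all add: case_prod_beta')
qed

text \<open>Hoeffding's lemma on \<open>[-K, K]\<close>: the width \<open>2 * K\<close> turns its
  exponent into \<open>\<theta>^2 * (2 * K)^2 / 8\<close>.\<close>

lemma (in prob_space) exp_centered_le:
  fixes f :: "'a \<Rightarrow> real"
  assumes f: "f \<in> borel_measurable M" and bound: "\<And>x. x \<in> space M \<Longrightarrow> \<bar>f x\<bar> \<le> K" and "0 < \<theta>"
  shows "(\<integral>x. exp (\<theta> * (f x - expectation f)) \<partial>M) \<le> exp (\<theta>\<^sup>2 * K\<^sup>2 / 2)"
proof -
  interpret interval_bounded_random_variable M f "- K" K
    by unfold_locales (use f bound in \<open>auto intro!: AE_I2 simp: abs_le_iff minus_le_iff\<close>)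
  have "(\<integral>\<^sup>+x. exp (\<theta> * (f x - expectation f)) \<partial>M) \<le> ennreal (exp (\<theta>\<^sup>2 * (K - - K)\<^sup>2 / 8))"
    by (rule Hoeffdings_lemma_nn_integral[OF \<open>0 < \<theta>\<close>])
  also have "\<theta>\<^sup>2 * (K - - K)\<^sup>2 / 8 = \<theta>\<^sup>2 * K\<^sup>2 / 2"
    by (simp add: power2_eq_square)
  finally have "enn2real (\<integral>\<^sup>+x. exp (\<theta> * (f x - expectation f)) \<partial>M) \<le> exp (\<theta>\<^sup>2 * K\<^sup>2 / 2)"
    by (rule enn2real_leI[OF exp_ge_zero])
  then show ?thesis
    using f by (subst integral_eq_nn_integral) auto
qed


text \<open>In \<open>\<beta>\<close>, the part \<open>ln T / \<theta>\<close> comes from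
  \<open>ln u \<le> ln T + u / T\<close>, and \<open>B\<close> pays for the extra 1 in the
  denominator \<open>N + 1\<close> of the estimates.\<close>

locale lcb_stochastic = lcb_environment G lo hi \<phi> \<eta> \<Lambda> \<beta> X Y C B + prob_space D
  for G :: "real set" and lo hi \<phi> \<eta> \<Lambda> \<beta> :: real and X :: "'x set" and Y C B
    and D :: "'x measure" +
  fixes T :: nat and \<theta> :: real
  assumes space_D: "space D = X" and T: "1 \<le> T" and \<theta>: "0 < \<theta>"
    and \<beta>: "\<beta> = ln (real T) / \<theta> + B"
    and Y_meas: "\<And>g. g \<in> G \<Longrightarrow> (\<lambda>x. Y x g) \<in> borel_measurable D"
    and C_meas: "\<And>g. g \<in> G \<Longrightarrow> (\<lambda>x. C x g) \<in> borel_measurable D"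
begin

abbreviation contexts :: "(nat \<Rightarrow> 'x) measure" where
  "contexts \<equiv> \<Pi>\<^sub>M t\<in>{1..T}. D"

abbreviation mean :: "('x \<Rightarrow> real \<Rightarrow> real) \<Rightarrow> real \<Rightarrow> real" where
  "mean \<equiv> mean_value D"

text \<open>One class that contains \<open>Y\<close>, \<open>C\<close> and their negatives, so that
  each deviation bound is proved once and yields both sides.\<close>

definition feedback :: "('x \<Rightarrow> real \<Rightarrow> real) \<Rightarrow> bool" where
  "feedback f \<longleftrightarrow> (\<forall>g\<in>G. (\<lambda>x. f x g) \<in> borel_measurable D \<and> (\<forall>x\<in>X. \<bar>f x g\<bar> \<le> B))"

lemma feedback_Y: "feedback Y"
  unfolding feedback_def
proof (intro ballI conjI Y_meas)
  fix g x assume "g \<in> G" "x \<in> X"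
  with Y_range[of x g] B show "\<bar>Y x g\<bar> \<le> B" by linarith
qed

lemma feedback_C: "feedback C"
  unfolding feedback_def
proof (intro ballI conjI C_meas)
  fix g x assume "g \<in> G" "x \<in> X"
  with C_range[of x g] show "\<bar>C x g\<bar> \<le> B" by linarith
qed

lemma feedback_uminus: "feedback f \<Longrightarrow> feedback (\<lambda>x g. - f x g)"
  by (simp add: feedback_def)

lemma feedback_integrable: "feedback f \<Longrightarrow> g \<in> G \<Longrightarrow> integrable D (\<lambda>x. f x g)"
  by (rule integrable_const_bound[where B = B]) (auto simp: feedback_def space_D intro!: AE_I2)

lemma mean_uminus: "mean (\<lambda>x g. - f x g) g = - mean f g"
  by (simp add: mean_value_def)

lemma abs_mean_le:
  assumes "feedback f" "g \<in> G"
  shows "\<bar>mean f g\<bar> \<le> B"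
proof -
  have "\<bar>mean f g\<bar> \<le> (\<integral>x. \<bar>f x g\<bar> \<partial>D)"
    unfolding mean_value_def by (rule integral_abs_bound)
  also have "\<dots> \<le> (\<integral>x. B \<partial>D)"
    using feedback_integrable[OF assms] assms
    by (intro integral_mono) (auto simp: feedback_def space_D)
  finally show ?thesis by (simp add: prob_space)
qed

sublocale N: prob_space contexts
  by (rule prob_space_PiM) (rule prob_space_axioms)

lemma contexts_in_X: "x \<in> space contexts \<Longrightarrow> i < T \<Longrightarrow> x (Suc i) \<in> X"
  by (auto simp: space_PiM PiE_iff space_D)

lemma integrable_bounded:
  fixes F :: "(nat \<Rightarrow> 'x) \<Rightarrow> real"
  assumes "F \<in> borel_measurable contexts" "\<And>x. x \<in> space contexts \<Longrightarrow> \<bar>F x\<bar> \<le> K"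
  shows "integrable contexts F"
  using assms by (intro N.integrable_const_bound[where B = K] AE_I2) simp_all

section \<open>Non-anticipation and measurability of the play\<close>

lemma observations_cong:
  assumes "\<And>i. i < t \<Longrightarrow> x (Suc i) = x' (Suc i)"
  shows "observations a Y C x t = observations a Y C x' t"
  using assms by (induction t) (simp_all add: Let_def)

text \<open>\<open>arm x s\<close> has seen only the contexts of steps 1 to \<open>s\<close>. Hence
  resampling the context of step \<open>Suc t\<close> acts as conditioning on the past of that
  step.\<close>

lemma arm_upd [simp]: "s \<le> t \<Longrightarrow> arm (x(Suc t := y)) s = arm x s"
  unfolding arm_def by (intro arg_cong[of _ _ policy] observations_cong) simp

lemma lam_upd: "lam (x(Suc t := y)) t = lam x t"
  unfolding lam_def by (rule sum.cong) simp_all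

lemma measurable_feedback_arm:
  assumes "feedback f" "i < T" "a \<in> contexts \<rightarrow>\<^sub>M count_space G"
  shows "(\<lambda>x. f (x (Suc i)) (a x)) \<in> borel_measurable contexts"
proof (rule measurable_compose_countable'[OF _ assms(3) countable_finite[OF finite_G]])
  fix g assume "g \<in> G"
  then have "(\<lambda>x. f x g) \<in> borel_measurable D"
    using assms(1) by (simp add: feedback_def)
  then show "(\<lambda>x. f (x (Suc i)) g) \<in> borel_measurable contexts"
    by (rule measurable_compose[rotated]) (rule measurable_component_singleton, use assms(2) in simp)
qed

lemma measurable_arm: "t \<le> T \<Longrightarrow> (\<lambda>x. arm x t) \<in> contexts \<rightarrow>\<^sub>M count_space G"
proof (induction t rule: less_induct)
  case (less t)
  have "(\<lambda>x. (Y (x (Suc i)) (arm x i), C (x (Suc i)) (arm x i))) \<in> contexts \<rightarrow>\<^sub>M borel \<Otimes>\<^sub>M borel"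
    if "i < t" for i
    using that less
    by (intro measurable_Pair measurable_feedback_arm feedback_Y feedback_C) simp_all
  then have "(\<lambda>x. policy (map (\<lambda>i. (Y (x (Suc i)) (arm x i), C (x (Suc i)) (arm x i))) [0..<t]))
      \<in> contexts \<rightarrow>\<^sub>M count_space G"
    by (rule measurable_policy)
  then show ?case
    by (simp only: arm_def[of _ t] observations_eq)
qed

lemma measurable_fun_arm:
  fixes h :: "real \<Rightarrow> real"
  shows "t \<le> T \<Longrightarrow> (\<lambda>x. h (arm x t)) \<in> borel_measurable contexts"
  by (rule measurable_compose[OF measurable_arm]) simp_all

lemma measurable_feedback:
  "feedback f \<Longrightarrow> t < T \<Longrightarrow> (\<lambda>x. f (x (Suc t)) (arm x t)) \<in> borel_measurable contexts"
  by (rule measurable_feedback_arm[OF _ _ measurable_arm]) simp_all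

lemma measurable_lam: "t \<le> T \<Longrightarrow> (\<lambda>x. lam x t) \<in> borel_measurable contexts"
  unfolding lam_def
  by (intro borel_measurable_sum borel_measurable_times borel_measurable_diff
      borel_measurable_const measurable_feedback feedback_Y) simp_all

text \<open>Given the past, the threshold is fixed and the next context is fresh, so integrating
  that context out replaces the feedback by its mean. The weight \<open>A\<close> will be the
  constant 1 or the multiplier.\<close>

lemma expectation_feedback:
  assumes f: "feedback f" and "t < T" and A: "A \<in> borel_measurable contexts"
    and bound: "\<And>x. x \<in> space contexts \<Longrightarrow> \<bar>A x\<bar> \<le> K"
    and past: "\<And>x y. A (x(Suc t := y)) = A x"
  shows "(\<integral>x. A x * f (x (Suc t)) (arm x t) \<partial>contexts) = (\<integral>x. A x * mean f (arm x t) \<partial>contexts)"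
proof -
  have "\<bar>A x * f (x (Suc t)) (arm x t)\<bar> \<le> K * B" if "x \<in> space contexts" for x
    unfolding abs_mult using f bound[OF that] contexts_in_X[OF that \<open>t < T\<close>] arm_in_G
    by (intro mult_mono') (auto simp: feedback_def)
  then have "(\<integral>x. A x * f (x (Suc t)) (arm x t) \<partial>contexts) =
      (\<integral>x. (\<integral>y. A (x(Suc t := y)) * f ((x(Suc t := y)) (Suc t)) (arm (x(Suc t := y)) t) \<partial>D) \<partial>contexts)"
    using \<open>t < T\<close> prob_space_axioms
    by (intro integral_PiM_resample(1) borel_measurable_times A measurable_feedback f) auto
  then show ?thesis
    by (simp add: past mean_value_def)
qed

section \<open>The exponential supermartingale\<close>

definition dev :: "('x \<Rightarrow> real \<Rightarrow> real) \<Rightarrow> (nat \<Rightarrow> 'x) \<Rightarrow> nat \<Rightarrow> real \<Rightarrow> real" where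
  "dev f x t g = total f x t g - real (plays x t g) * mean f g"

text \<open>The variance proxy \<open>\<theta>^2 * B^2 / 2\<close> is charged only when
  \<open>g\<close> is played, so the compensator counts plays and not steps.\<close>

definition growth :: "('x \<Rightarrow> real \<Rightarrow> real) \<Rightarrow> (nat \<Rightarrow> 'x) \<Rightarrow> nat \<Rightarrow> real \<Rightarrow> real" where
  "growth f x t g = exp (\<theta> * dev f x t g - \<theta>\<^sup>2 * B\<^sup>2 / 2 * real (plays x t g))"

lemma growth_Suc:
  "growth f x (Suc t) g = growth f x t g *
     (if arm x t = g then exp (\<theta> * (f (x (Suc t)) g - mean f g) - \<theta>\<^sup>2 * B\<^sup>2 / 2) else 1)"
  by (simp add: growth_def dev_def total_def plays_def mult_exp_exp algebra_simps)

lemma growth_upd: "growth f (x(Suc t := y)) t g = growth f x t g"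
proof -
  have "total f (x(Suc t := y)) t g = total f x t g"
    unfolding total_def by (rule sum.cong) simp_all
  moreover have "plays (x(Suc t := y)) t g = plays x t g"
    unfolding plays_def by (rule sum.cong) simp_all
  ultimately show ?thesis
    by (simp add: growth_def dev_def)
qed

lemma measurable_growth:
  assumes f: "feedback f" and g: "g \<in> G" and "t \<le> T"
  shows "(\<lambda>x. growth f x t g) \<in> borel_measurable contexts"
  using \<open>t \<le> T\<close>
proof (induction t)
  case 0
  then show ?case by (simp add: growth_def dev_def total_def plays_def)
next
  case (Suc t)
  have growth_eq: "growth f x (Suc t) g = growth f x t g *
      (of_bool (arm x t = g) * exp (\<theta> * (f (x (Suc t)) g - mean f g) - \<theta>\<^sup>2 * B\<^sup>2 / 2)
        + of_bool (arm x t \<noteq> g))" for x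
    by (simp add: growth_Suc)
  have [measurable]: "(\<lambda>x. f (x (Suc t)) g) \<in> borel_measurable contexts"
    by (rule measurable_feedback_arm[OF f]) (use Suc.prems g in simp_all)
  have [measurable]: "(\<lambda>x. growth f x t g) \<in> borel_measurable contexts"
      "(\<lambda>x. of_bool (arm x t = g) :: real) \<in> borel_measurable contexts"
      "(\<lambda>x. of_bool (arm x t \<noteq> g) :: real) \<in> borel_measurable contexts"
    using Suc measurable_fun_arm by simp_all
  show ?case
    unfolding growth_eq by measurable
qed

text \<open>A crude bound for integrability: a play of \<open>g\<close> multiplies
  \<open>growth\<close> by at most \<open>exp (2 * \<theta> * B)\<close>, and any other step leaves
  it unchanged.\<close>

lemma growth_bound:
  assumes f: "feedback f" and g: "g \<in> G" and "t \<le> T" and x: "x \<in> space contexts"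
  shows "\<bar>growth f x t g\<bar> \<le> exp (2 * \<theta> * B) ^ t"
  using \<open>t \<le> T\<close>
proof (induction t)
  case 0
  then show ?case by (simp add: growth_def dev_def total_def plays_def)
next
  case (Suc t)
  have "f (x (Suc t)) g - mean f g \<le> 2 * B"
    using f g contexts_in_X[OF x, of t] Suc.prems abs_mean_le[OF f g]
    unfolding feedback_def by (smt (verit) Suc_le_eq)
  then have "\<theta> * (f (x (Suc t)) g - mean f g) \<le> \<theta> * (2 * B)"
    using \<theta> by (intro mult_left_mono) simp_all
  moreover have "0 \<le> \<theta>\<^sup>2 * B\<^sup>2 / 2" "0 \<le> \<theta> * B"
    using \<theta> B by simp_all
  ultimately have "\<theta> * (f (x (Suc t)) g - mean f g) - \<theta>\<^sup>2 * B\<^sup>2 / 2 \<le> 2 * \<theta> * B"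
      "0 \<le> 2 * \<theta> * B"
    by linarith+
  then have "(if arm x t = g then exp (\<theta> * (f (x (Suc t)) g - mean f g) - \<theta>\<^sup>2 * B\<^sup>2 / 2) else 1)
      \<le> exp (2 * \<theta> * B)"
    by (simp del: mult_le_cancel_left_pos)
  then have "growth f x (Suc t) g \<le> exp (2 * \<theta> * B) ^ t * exp (2 * \<theta> * B)"
    unfolding growth_Suc using Suc by (intro mult_mono) (simp_all add: growth_def)
  then show ?case
    by (simp add: growth_def mult.commute)
qed

lemma integrable_growth:
  "feedback f \<Longrightarrow> g \<in> G \<Longrightarrow> t \<le> T \<Longrightarrow> integrable contexts (\<lambda>x. growth f x t g)"
  by (rule integrable_bounded[OF measurable_growth growth_bound])

text \<open>Supermartingale property: integrating out the newest context gives a factor at most 1 by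
  Hoeffding's lemma if \<open>g\<close> is played, and exactly 1 otherwise.\<close>

lemma expectation_growth_le:
  assumes f: "feedback f" and g: "g \<in> G" and "t \<le> T"
  shows "(\<integral>x. growth f x t g \<partial>contexts) \<le> 1"
  using \<open>t \<le> T\<close>
proof (induction t)
  case 0
  then show ?case
    by (simp add: growth_def dev_def total_def plays_def N.prob_space del: One_nat_def)
next
  case (Suc t)
  have D_T: "prob_space D" "Suc t \<in> {1..T}"
    using prob_space_axioms Suc.prems by simp_all
  note resample = integral_PiM_resample[of "{1..T}" "\<lambda>_. D", OF D_T
      measurable_growth[OF f g Suc.prems] growth_bound[OF f g Suc.prems]]
  have step: "(\<integral>y. growth f (x(Suc t := y)) (Suc t) g \<partial>D) \<le> growth f x t g" for x
  proof (cases "arm x t = g")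
    case True
    have "(\<integral>y. exp (\<theta> * (f y g - mean f g)) \<partial>D) \<le> exp (\<theta>\<^sup>2 * B\<^sup>2 / 2)"
      unfolding mean_value_def
      by (rule exp_centered_le) (use f g \<theta> in \<open>auto simp: feedback_def space_D\<close>)
    then have "growth f x t g * (\<integral>y. exp (\<theta> * (f y g - mean f g)) \<partial>D) / exp (\<theta>\<^sup>2 * B\<^sup>2 / 2)
        \<le> growth f x t g"
      by (simp add: growth_def pos_divide_le_eq)
    then show ?thesis
      using True by (simp add: growth_Suc growth_upd exp_diff)
  next
    case False
    then show ?thesis
      by (simp add: growth_Suc growth_upd prob_space)
  qed
  have "(\<integral>x. growth f x (Suc t) g \<partial>contexts)
      = (\<integral>x. (\<integral>y. growth f (x(Suc t := y)) (Suc t) g \<partial>D) \<partial>contexts)"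
    using resample(1) by simp
  also have "\<dots> \<le> (\<integral>x. growth f x t g \<partial>contexts)"
    using resample(2) Suc.prems f g step by (intro integral_mono integrable_growth) simp_all
  also have "\<dots> \<le> 1"
    using Suc by simp
  finally show ?case .
qed

end

section \<open>Expected cost against a benchmark\<close>

context lcb_stochastic
begin

section \<open>Confidence bounds on every path\<close>

lemma growth_nonneg: "0 \<le> growth f x t g"
  by (simp add: growth_def)

text \<open>Apply \<open>ln u \<le> u - 1\<close> to \<open>u = growth / T\<close> and divide by
  \<open>\<theta>\<close>. The bound holds on every path; what a high-probability bound would put
  into a failure event is the last term, small in expectation.\<close>

lemma dev_le: "dev f x t g \<le> ln (real T) / \<theta> + \<theta> * B\<^sup>2 / 2 * real (plays x t g) + growth f x t g / (real T * \<theta>)"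
proof -
  have "ln (growth f x t g / real T) \<le> growth f x t g / real T - 1"
    using T by (intro ln_le_minus_one) (simp add: growth_def)
  moreover have "ln (growth f x t g / real T)
      = \<theta> * dev f x t g - \<theta>\<^sup>2 * B\<^sup>2 / 2 * real (plays x t g) - ln (real T)"
    using T by (subst ln_div) (simp_all add: growth_def)
  ultimately have "\<theta> * dev f x t g
      \<le> ln (real T) + \<theta>\<^sup>2 * B\<^sup>2 / 2 * real (plays x t g) + growth f x t g / real T"
    by linarith
  then have "dev f x t g
      \<le> (ln (real T) + \<theta>\<^sup>2 * B\<^sup>2 / 2 * real (plays x t g) + growth f x t g / real T) / \<theta>"
    using \<theta> by (simp add: pos_le_divide_eq mult.commute)
  also have "\<dots> = ln (real T) / \<theta> + \<theta> * B\<^sup>2 / 2 * real (plays x t g) + growth f x t g / (real T * \<theta>)"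
    using \<theta> by (simp add: add_divide_distrib power2_eq_square)
  finally show ?thesis .
qed

text \<open>Dividing by \<open>N + 1\<close> instead of \<open>N\<close> shrinks the estimate
  towards 0 and adds a bias of at most \<open>B / (N + 1)\<close>. The rest is \<open>dev_le\<close>
  for the negated feedback, with \<open>\<rho> * N + w\<close> enlarged to
  \<open>(\<rho> + w) * (N + 1)\<close>.\<close>

lemma confidence:
  assumes "feedback f" "g \<in> G"
  shows "mean f g - total f x t g / (real (plays x t g) + 1)
    \<le> \<beta> / (real (plays x t g) + 1) + \<theta> * B\<^sup>2 / 2 + growth (\<lambda>x g. - f x g) x t g / (real T * \<theta>)"
proof -
  define N where "N = real (plays x t g)"
  define w where "w = growth (\<lambda>x g. - f x g) x t g / (real T * \<theta>)"
  define \<rho> where "\<rho> = \<theta> * B\<^sup>2 / 2"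
  have N: "0 \<le> N" and w: "0 \<le> w" and \<rho>: "0 \<le> \<rho>"
    using \<theta> by (simp_all add: N_def w_def \<rho>_def growth_nonneg)
  have "total (\<lambda>x g. - f x g) x t g = - total f x t g"
    by (simp add: total_def sum_negf)
  then have "mean f g * (N + 1) - total f x t g = mean f g + dev (\<lambda>x g. - f x g) x t g"
    by (simp add: dev_def mean_uminus N_def algebra_simps)
  also have "\<dots> \<le> B + (ln (real T) / \<theta> + \<rho> * N + w)"
    using abs_mean_le[OF assms] dev_le[of "\<lambda>x g. - f x g" x t g] unfolding N_def w_def \<rho>_def by linarith
  also have "\<dots> \<le> \<beta> + (\<rho> + w) * (N + 1)"
    using N w \<rho> by (simp add: \<beta> algebra_simps)
  finally have "(mean f g * (N + 1) - total f x t g) / (N + 1)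
      \<le> (\<beta> + (\<rho> + w) * (N + 1)) / (N + 1)"
    using N by (intro divide_right_mono) simp_all
  then show ?thesis
    using N unfolding w_def[symmetric] N_def[symmetric] \<rho>_def[symmetric]
    by (simp add: diff_divide_distrib add_divide_distrib)
qed

text \<open>A single quantity dominating all four failure terms at every grid point. Summing over
  \<open>G\<close> covers the played arm, which depends on the data.\<close>

definition excess :: "(nat \<Rightarrow> 'x) \<Rightarrow> nat \<Rightarrow> real" where
  "excess x t = (\<Sum>g\<in>G. (growth C x t g + growth (\<lambda>x g. - C x g) x t g
     + growth Y x t g + growth (\<lambda>x g. - Y x g) x t g) / (real T * \<theta>))"

lemma growth_le_excess:
  assumes "g \<in> G"
  shows "growth C x t g / (real T * \<theta>) + growth (\<lambda>x g. - C x g) x t g / (real T * \<theta>)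
     + growth Y x t g / (real T * \<theta>) + growth (\<lambda>x g. - Y x g) x t g / (real T * \<theta>) \<le> excess x t"
  unfolding excess_def add_divide_distrib[symmetric]
  by (rule member_le_sum[OF assms _ finite_G]) (use \<theta> in \<open>simp add: growth_nonneg\<close>)

lemma excess_nonneg: "0 \<le> excess x t"
  unfolding excess_def using \<theta> by (intro sum_nonneg divide_nonneg_nonneg add_nonneg_nonneg growth_nonneg) simp_all

section \<open>Lagrangian cost of the played threshold\<close>

definition lagrangian :: "real \<Rightarrow> real \<Rightarrow> real" where
  "lagrangian l g = mean C g + l * (\<phi> - mean Y g)"

text \<open>Optimism: the index of the comparator \<open>g\<close> already subtracts its bonus,
  which cancels its estimation error. Only the bonus of the played arm remains, once for its error
  and once for its index.\<close>

lemma lagrangian_arm_le_arm: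
  assumes lam: "0 \<le> lam x t" "lam x t \<le> \<Lambda>" and g: "g \<in> G"
  shows "lagrangian (lam x t) (arm x t) \<le> lagrangian (lam x t) g
    + (1 + \<Lambda>) * (2 * \<beta> * (1 / (real (plays x t (arm x t)) + 1)) + \<theta> * B\<^sup>2 + 2 * excess x t)"
proof -
  define l where "l = lam x t"
  define \<rho> where "\<rho> = \<theta> * B\<^sup>2 / 2"
  define E where "E = excess x t"
  define N where "N h = real (plays x t h) + 1" for h
  define estC where "estC h = total C x t h / N h" for h
  define estY where "estY h = total Y x t h / N h" for h
  have l: "0 \<le> l" "l \<le> \<Lambda>" using lam by (simp_all add: l_def)
  have "1 \<le> N h" for h by (simp add: N_def)
  have "0 \<le> \<beta>" using T \<theta> B by (simp add: \<beta>)
  define b where "b h = \<beta> / N h" for h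
  have bonus: "0 \<le> b h" for h
    using \<open>0 \<le> \<beta>\<close> \<open>1 \<le> N h\<close> by (simp add: b_def)
  have index_eq: "index x t h = estC h - l * estY h - (1 + l) * (b h)" for h
    unfolding index_def estC_def estY_def N_def l_def b_def by (simp add: diff_divide_distrib)
  have neg: "total (\<lambda>x g. - f x g) x t h = - total f x t h" for f h
    by (simp add: total_def sum_negf)
  have E4: "growth C x t h / (real T * \<theta>) \<le> E" "growth (\<lambda>x g. - C x g) x t h / (real T * \<theta>) \<le> E"
    "growth Y x t h / (real T * \<theta>) \<le> E" "growth (\<lambda>x g. - Y x g) x t h / (real T * \<theta>) \<le> E"
    if "h \<in> G" for h
    using growth_le_excess[OF that, of x t] growth_nonneg[of _ x t h] \<theta> unfolding E_def
    by (smt (verit) divide_nonneg_nonneg mult_nonneg_nonneg of_nat_0_le_iff)+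
  have C_lower: "mean C h - estC h \<le> b h + \<rho> + E" if "h \<in> G" for h
    using confidence[OF feedback_C that, of x t] E4(2)[OF that]
    unfolding estC_def N_def \<rho>_def b_def by linarith
  have C_upper: "estC h - mean C h \<le> b h + \<rho> + E" if "h \<in> G" for h
    using confidence[OF feedback_uminus[OF feedback_C] that, of x t] E4(1)[OF that]
    unfolding estC_def N_def \<rho>_def b_def mean_uminus neg by simp
  have Y_lower: "mean Y h - estY h \<le> b h + \<rho> + E" if "h \<in> G" for h
    using confidence[OF feedback_Y that, of x t] E4(4)[OF that]
    unfolding estY_def N_def \<rho>_def b_def by linarith
  have Y_upper: "estY h - mean Y h \<le> b h + \<rho> + E" if "h \<in> G" for h
    using confidence[OF feedback_uminus[OF feedback_Y] that, of x t] E4(3)[OF that]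
    unfolding estY_def N_def \<rho>_def b_def mean_uminus neg by simp
  let ?a = "arm x t"
  have "mean C ?a - l * mean Y ?a \<le> estC ?a - l * estY ?a + (1 + l) * (b ?a + \<rho> + E)"
    using C_lower[OF arm_in_G, of x t] mult_left_mono[OF Y_upper[OF arm_in_G, of x t] l(1)]
    by (simp add: algebra_simps)
  also have "\<dots> = index x t ?a + (1 + l) * (2 * (b ?a) + \<rho> + E)"
    by (simp add: index_eq algebra_simps)
  also have "index x t ?a \<le> index x t g"
    by (rule index_arm_le[OF lam g])
  also have "index x t g \<le> mean C g - l * mean Y g + (1 + l) * (\<rho> + E)"
    using C_upper[OF g] mult_left_mono[OF Y_lower[OF g] l(1)]
    by (simp add: index_eq algebra_simps)
  finally have "mean C ?a - l * mean Y ?a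
      \<le> mean C g - l * mean Y g + (1 + l) * (2 * (b ?a) + 2 * \<rho> + 2 * E)"
    by (simp add: algebra_simps)
  also have "(1 + l) * (2 * (b ?a) + 2 * \<rho> + 2 * E)
      \<le> (1 + \<Lambda>) * (2 * (b ?a) + 2 * \<rho> + 2 * E)"
    using l bonus[of ?a] excess_nonneg[of x t] \<theta>
    by (intro mult_right_mono) (simp_all add: \<rho>_def E_def)
  finally show ?thesis
    unfolding lagrangian_def l_def[symmetric] N_def[symmetric] E_def[symmetric]
    by (simp add: \<rho>_def b_def algebra_simps)
qed

text \<open>The benchmark enters only through one good grid point for each multiplier. As this point
  may change with \<open>l\<close>, a deterministic policy can compete with randomised benchmarks.
  In forced steps the Lagrangian cost is at most 0, hence at most \<open>v\<close>.\<close>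

lemma lagrangian_arm_le:
  assumes v: "0 \<le> v" and compare: "\<And>l. 0 \<le> l \<Longrightarrow> \<exists>g\<in>G. lagrangian l g \<le> v"
  shows "lagrangian (lam x t) (arm x t)
    \<le> v + (1 + \<Lambda>) * (2 * \<beta> * (1 / (real (plays x t (arm x t)) + 1)) + \<theta> * B\<^sup>2 + 2 * excess x t)"
    (is "_ \<le> v + ?e")
proof -
  have "0 \<le> \<beta>" using T \<theta> B by (simp add: \<beta>)
  then have e: "0 \<le> ?e"
    using \<Lambda>_nonneg \<theta> excess_nonneg[of x t]
    by (intro mult_nonneg_nonneg add_nonneg_nonneg) simp_all
  consider "lam x t < 0" | "\<Lambda> < lam x t" | "0 \<le> lam x t" "lam x t \<le> \<Lambda>"
    by linarith
  then show ?thesis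
  proof cases
    case 1
    have "mean C lo = (\<integral>x. 0 \<partial>D)" "mean Y lo = (\<integral>x. 0 \<partial>D)"
      unfolding mean_value_def by (rule Bochner_Integration.integral_cong; simp add: space_D C_lo Y_lo)+
    then have "lagrangian (lam x t) (arm x t) = lam x t * \<phi>"
      using 1 by (simp add: lagrangian_def arm_unfold)
    also have "\<dots> \<le> 0" using 1 \<phi> by (simp add: mult_nonpos_nonneg)
    finally show ?thesis using v e by linarith
  next
    case 2
    have "mean Y hi = (\<integral>x. 1 \<partial>D)"
      unfolding mean_value_def by (rule Bochner_Integration.integral_cong) (simp_all add: space_D Y_hi)
    then have "lagrangian (lam x t) (arm x t) = mean C hi - lam x t * (1 - \<phi>)"
      using 2 \<Lambda>_nonneg by (simp add: lagrangian_def arm_unfold prob_space algebra_simps)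
    moreover have "mean C hi \<le> B"
      using abs_mean_le[OF feedback_C hi_in_G] by linarith
    moreover have "B \<le> lam x t * (1 - \<phi>)"
      using 2 \<phi> by (simp add: \<Lambda> pos_divide_less_eq)
    ultimately show ?thesis using v e by linarith
  next
    case 3
    from compare[OF 3(1)] obtain g where "g \<in> G" "lagrangian (lam x t) g \<le> v"
      by blast
    with lagrangian_arm_le_arm[OF 3, of g] show ?thesis by linarith
  qed
qed

section \<open>From Lagrangian cost to expected cost\<close>

lemma integrable_excess: "t \<le> T \<Longrightarrow> integrable contexts (\<lambda>x. excess x t)"
  unfolding excess_def
  by (intro Bochner_Integration.integrable_sum integrable_divide_zero Bochner_Integration.integrable_add
      integrable_growth feedback_C feedback_Y feedback_uminus)

lemma expectation_excess_le:
  assumes "t \<le> T"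
  shows "(\<integral>x. excess x t \<partial>contexts) \<le> 4 * real (card G) / (real T * \<theta>)"
proof -
  have "(\<integral>x. excess x t \<partial>contexts) =
      (\<Sum>g\<in>G. ((\<integral>x. growth C x t g \<partial>contexts) + (\<integral>x. growth (\<lambda>x g. - C x g) x t g \<partial>contexts)
        + (\<integral>x. growth Y x t g \<partial>contexts) + (\<integral>x. growth (\<lambda>x g. - Y x g) x t g \<partial>contexts)) / (real T * \<theta>))"
    unfolding excess_def using assms
    by (simp add: integrable_growth feedback_C feedback_Y feedback_uminus del: One_nat_def)
  also have "\<dots> \<le> (\<Sum>g\<in>G. 4 / (real T * \<theta>))"
  proof (rule sum_mono)
    fix g assume g: "g \<in> G"
    have "(\<integral>x. growth f x t g \<partial>contexts) \<le> 1" if "feedback f" for f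
      by (rule expectation_growth_le[OF that g assms])
    from this[OF feedback_C] this[OF feedback_uminus[OF feedback_C]]
      this[OF feedback_Y] this[OF feedback_uminus[OF feedback_Y]]
    show "((\<integral>x. growth C x t g \<partial>contexts) + (\<integral>x. growth (\<lambda>x g. - C x g) x t g \<partial>contexts)
        + (\<integral>x. growth Y x t g \<partial>contexts) + (\<integral>x. growth (\<lambda>x g. - Y x g) x t g \<partial>contexts)) / (real T * \<theta>)
      \<le> 4 / (real T * \<theta>)"
      using \<theta> by (intro divide_right_mono) simp_all
  qed
  finally show ?thesis by (simp add: mult.commute)
qed

lemma abs_lam_le: "x \<in> space contexts \<Longrightarrow> t \<le> T \<Longrightarrow> \<bar>lam x t\<bar> \<le> \<Lambda> + \<eta>"
  using lam_bounds[of t x] contexts_in_X[of x] \<Lambda>_nonneg by (simp add: abs_le_iff)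

lemma integrable_cost: "t < T \<Longrightarrow> integrable contexts (\<lambda>x. C (x (Suc t)) (arm x t))"
  by (rule integrable_bounded[OF measurable_feedback[OF feedback_C], where K = B])
     (use feedback_C contexts_in_X arm_in_G in \<open>auto simp: feedback_def\<close>)

theorem expected_cost_le:
  assumes v: "0 \<le> v" and compare: "\<And>l. 0 \<le> l \<Longrightarrow> \<exists>g\<in>G. lagrangian l g \<le> v"
  shows "(\<integral>x. (\<Sum>t<T. C (x (Suc t)) (arm x t)) \<partial>contexts)
    \<le> real T * v + (1 + \<Lambda>) * (2 * \<beta> * (real (card G) * (1 + ln (real T))) + real T * \<theta> * B\<^sup>2
      + 8 * real (card G) / \<theta>) + \<eta> * real T / 2"
proof -
  let ?drift = "\<lambda>x t. lam x t * (\<phi> - Y (x (Suc t)) (arm x t))"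
  let ?c = "\<lambda>x t. C (x (Suc t)) (arm x t)"
  have Y_prod: "\<bar>lam x t * Y (x (Suc t)) (arm x t)\<bar> \<le> (\<Lambda> + \<eta>) * B"
    and mean_prod: "\<bar>lam x t * mean Y (arm x t)\<bar> \<le> (\<Lambda> + \<eta>) * B"
    if "x \<in> space contexts" "t < T" for x t
    unfolding abs_mult
    using abs_lam_le[of x t] that feedback_Y contexts_in_X[OF that] arm_in_G[of x t]
      abs_mean_le[OF feedback_Y arm_in_G]
    by (intro mult_mono'; simp add: feedback_def)+
  have int_lam: "integrable contexts (\<lambda>x. lam x t)" if "t < T" for t
    using that by (intro integrable_bounded[OF measurable_lam abs_lam_le]) simp_all
  have int_Y: "integrable contexts (\<lambda>x. lam x t * Y (x (Suc t)) (arm x t))" if "t < T" for t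
    using that by (intro integrable_bounded[OF _ Y_prod] borel_measurable_times measurable_lam
        measurable_feedback feedback_Y) simp_all
  have int_mean_Y: "integrable contexts (\<lambda>x. lam x t * mean Y (arm x t))" if "t < T" for t
    using that by (intro integrable_bounded[OF _ mean_prod] borel_measurable_times measurable_lam
        measurable_fun_arm) simp_all
  have int_mean_C: "integrable contexts (\<lambda>x. mean C (arm x t))" if "t < T" for t
    using that by (intro integrable_bounded[OF _ abs_mean_le[OF feedback_C arm_in_G]] measurable_fun_arm) simp
  have int_step: "integrable contexts (\<lambda>x. ?c x t + ?drift x t)" if "t < T" for t
    using integrable_cost int_lam int_Y that by (simp add: right_diff_distrib del: One_nat_def)
  have int_lagr: "integrable contexts (\<lambda>x. lagrangian (lam x t) (arm x t))" if "t < T" for t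
    using int_mean_C int_lam int_mean_Y that
    by (simp add: lagrangian_def right_diff_distrib del: One_nat_def)
  \<comment> \<open>Threshold and multiplier are fixed before the context is drawn, so
    \<open>expectation_feedback\<close> applies with weight 1 to the cost and weight
    \<open>lam x t\<close> to the success.\<close>
  have step: "(\<integral>x. ?c x t + ?drift x t \<partial>contexts) = (\<integral>x. lagrangian (lam x t) (arm x t) \<partial>contexts)"
    if "t < T" for t
  proof -
    have "(\<integral>x. 1 * ?c x t \<partial>contexts) = (\<integral>x. 1 * mean C (arm x t) \<partial>contexts)"
      using that by (intro expectation_feedback[OF feedback_C, where K = 1]) simp_all
    moreover have "(\<integral>x. lam x t * Y (x (Suc t)) (arm x t) \<partial>contexts)
        = (\<integral>x. lam x t * mean Y (arm x t) \<partial>contexts)"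
      using that by (intro expectation_feedback[OF feedback_Y _ measurable_lam abs_lam_le])
        (simp_all add: lam_upd)
    ultimately show ?thesis
      using integrable_cost int_lam int_Y int_mean_C int_mean_Y that
      by (simp add: lagrangian_def right_diff_distrib del: One_nat_def)
  qed
  have bound: "(\<Sum>t<T. lagrangian (lam x t) (arm x t))
      \<le> real T * v + (1 + \<Lambda>) * (2 * \<beta> * (real (card G) * (1 + ln (real T))) + real T * \<theta> * B\<^sup>2)
        + (1 + \<Lambda>) * 2 * (\<Sum>t<T. excess x t)" for x
  proof -
    have "0 \<le> \<beta>" using T \<theta> B by (simp add: \<beta>)
    have "(\<Sum>t<T. lagrangian (lam x t) (arm x t)) \<le>
        (\<Sum>t<T. v + (1 + \<Lambda>) * (2 * \<beta> * (1 / (real (plays x t (arm x t)) + 1)) + \<theta> * B\<^sup>2 + 2 * excess x t))"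
      by (intro sum_mono lagrangian_arm_le assms)
    also have "\<dots> = real T * v + (1 + \<Lambda>) * (2 * \<beta> * (\<Sum>t<T. 1 / (real (plays x t (arm x t)) + 1))
        + real T * \<theta> * B\<^sup>2) + (1 + \<Lambda>) * 2 * (\<Sum>t<T. excess x t)"
    proof -
      have "(\<Sum>t<T. v + (1 + \<Lambda>) * (2 * \<beta> * u t + \<theta> * B\<^sup>2 + 2 * e t))
          = real T * v + (1 + \<Lambda>) * (2 * \<beta> * (\<Sum>t<T. u t) + real T * \<theta> * B\<^sup>2)
            + (1 + \<Lambda>) * 2 * (\<Sum>t<T. e t)" for u e
        by (simp add: sum.distrib sum_distrib_left algebra_simps)
      then show ?thesis .
    qed
    also have "\<dots> \<le> real T * v + (1 + \<Lambda>) * (2 * \<beta> * (real (card G) * (1 + ln (real T)))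
        + real T * \<theta> * B\<^sup>2) + (1 + \<Lambda>) * 2 * (\<Sum>t<T. excess x t)"
      using \<open>0 \<le> \<beta>\<close> \<Lambda>_nonneg
      by (intro add_right_mono add_left_mono mult_left_mono sum_bonus_le T) simp_all
    finally show ?thesis .
  qed
  have int_excess: "integrable contexts (\<lambda>x. \<Sum>t<T. excess x t)"
    by (intro Bochner_Integration.integrable_sum integrable_excess) simp
  have integral_sum_const: "(\<integral>x. (\<Sum>t<T. f x t) + k \<partial>contexts) = (\<Sum>t<T. \<integral>x. f x t \<partial>contexts) + k"
    if f: "\<And>t. t < T \<Longrightarrow> integrable contexts (\<lambda>x. f x t)" for f :: "(nat \<Rightarrow> 'x) \<Rightarrow> nat \<Rightarrow> real" and k
  proof -
    have "integrable contexts (\<lambda>x. \<Sum>t<T. f x t)"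
      using f by (intro Bochner_Integration.integrable_sum) simp
    then have "(\<integral>x. (\<Sum>t<T. f x t) + k \<partial>contexts) = (\<integral>x. (\<Sum>t<T. f x t) \<partial>contexts) + k"
      by (simp add: N.prob_space del: One_nat_def)
    then show ?thesis
      using f by (simp add: Bochner_Integration.integral_sum del: One_nat_def)
  qed
  \<comment> \<open>The drift terms are added on each path at the price
    \<open>\<eta> * T / 2\<close>, which turns costs into Lagrangian costs.\<close>
  have "(\<integral>x. (\<Sum>t<T. ?c x t) \<partial>contexts) \<le> (\<integral>x. (\<Sum>t<T. ?c x t + ?drift x t) + \<eta> * real T / 2 \<partial>contexts)"
  proof (rule integral_mono)
    fix x assume "x \<in> space contexts"
    then show "(\<Sum>t<T. ?c x t) \<le> (\<Sum>t<T. ?c x t + ?drift x t) + \<eta> * real T / 2"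
      using sum_lam_drift_ge[of T x] contexts_in_X[of x] by (simp add: sum.distrib)
  qed (intro Bochner_Integration.integrable_add Bochner_Integration.integrable_sum integrable_cost
      int_step N.integrable_const; simp)+
  also have "\<dots> = (\<Sum>t<T. \<integral>x. ?c x t + ?drift x t \<partial>contexts) + \<eta> * real T / 2"
    by (rule integral_sum_const) (rule int_step)
  also have "(\<Sum>t<T. \<integral>x. ?c x t + ?drift x t \<partial>contexts)
      = (\<integral>x. (\<Sum>t<T. lagrangian (lam x t) (arm x t)) \<partial>contexts)"
  proof -
    have "(\<Sum>t<T. \<integral>x. ?c x t + ?drift x t \<partial>contexts)
        = (\<Sum>t<T. \<integral>x. lagrangian (lam x t) (arm x t) \<partial>contexts)"
      by (rule sum.cong[OF refl]) (rule step, simp)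
    also have "\<dots> = (\<integral>x. (\<Sum>t<T. lagrangian (lam x t) (arm x t)) \<partial>contexts)"
      by (rule Bochner_Integration.integral_sum[symmetric]) (rule int_lagr, simp)
    finally show ?thesis .
  qed
  also have "\<dots> \<le> (\<integral>x. real T * v + (1 + \<Lambda>) * (2 * \<beta> * (real (card G) * (1 + ln (real T)))
        + real T * \<theta> * B\<^sup>2) + (1 + \<Lambda>) * 2 * (\<Sum>t<T. excess x t) \<partial>contexts)"
  proof (rule integral_mono[OF _ _ bound])
    show "integrable contexts (\<lambda>x. \<Sum>t<T. lagrangian (lam x t) (arm x t))"
      by (rule Bochner_Integration.integrable_sum) (rule int_lagr, simp)
  qed (use int_excess in \<open>simp del: One_nat_def\<close>)
  also have "\<dots> = real T * v + (1 + \<Lambda>) * (2 * \<beta> * (real (card G) * (1 + ln (real T)))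
        + real T * \<theta> * B\<^sup>2) + (1 + \<Lambda>) * 2 * (\<Sum>t<T. \<integral>x. excess x t \<partial>contexts)"
    using int_excess integrable_excess by (simp add: N.prob_space del: One_nat_def)
  finally have *: "(\<integral>x. (\<Sum>t<T. ?c x t) \<partial>contexts) \<le> real T * v
      + (1 + \<Lambda>) * (2 * \<beta> * (real (card G) * (1 + ln (real T))) + real T * \<theta> * B\<^sup>2)
      + (1 + \<Lambda>) * 2 * (\<Sum>t<T. \<integral>x. excess x t \<partial>contexts) + \<eta> * real T / 2"
    by simp
  have "(\<Sum>t<T. \<integral>x. excess x t \<partial>contexts) \<le> (\<Sum>t<T. 4 * real (card G) / (real T * \<theta>))"
    by (intro sum_mono expectation_excess_le) simp
  also have "\<dots> = 4 * real (card G) / \<theta>"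
    using T by simp
  finally have "(1 + \<Lambda>) * 2 * (\<Sum>t<T. \<integral>x. excess x t \<partial>contexts)
      \<le> (1 + \<Lambda>) * 2 * (4 * real (card G) / \<theta>)"
    using \<Lambda>_nonneg by (intro mult_left_mono) simp_all
  also have "\<dots> = (1 + \<Lambda>) * (8 * real (card G) / \<theta>)"
    by simp
  finally show ?thesis
    using * unfolding distrib_left[of "1 + \<Lambda>"] by linarith
qed

end

section \<open>Grid, benchmark and rates\<close>

lemma threshold_grid_card:
  assumes "0 < \<delta>" "lo < hi"
  shows "finite (threshold_grid lo hi \<delta>)"
    and "real (card (threshold_grid lo hi \<delta>)) \<le> (hi - lo) / \<delta> + 2"
proof -
  \<comment> \<open>\<open>m\<close> is the largest \<open>k\<close> with
    \<open>lo + k * \<delta> \<le> hi\<close>: at most \<open>m + 1\<close> regular points, and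
    \<open>hi\<close> adds one more.\<close>
  define m where "m = nat \<lfloor>(hi - lo) / \<delta>\<rfloor>"
  have sub: "threshold_grid lo hi \<delta> \<subseteq> insert hi ((\<lambda>k. lo + real k * \<delta>) ` {..m})"
  proof
    fix g assume "g \<in> threshold_grid lo hi \<delta>"
    then consider "g = hi" | k where "g = lo + real k * \<delta>" "g \<le> hi"
      by (auto simp: threshold_grid_def)
    then show "g \<in> insert hi ((\<lambda>k. lo + real k * \<delta>) ` {..m})"
    proof cases
      case (2 k)
      then have "real k \<le> (hi - lo) / \<delta>"
        using assms by (simp add: pos_le_divide_eq)
      then have "k \<le> m"
        by (simp add: m_def le_nat_floor)
      with 2 show ?thesis by auto
    qed simp
  qed
  show "finite (threshold_grid lo hi \<delta>)"
    by (rule finite_subset[OF sub]) simp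
  have "card (threshold_grid lo hi \<delta>) \<le> card (insert hi ((\<lambda>k. lo + real k * \<delta>) ` {..m}))"
    by (rule card_mono[OF _ sub]) simp
  also have "\<dots> \<le> Suc (card ((\<lambda>k. lo + real k * \<delta>) ` {..m}))"
    by (rule card_insert_le_m1) simp_all
  also have "\<dots> \<le> Suc (Suc m)"
    using card_image_le[of "{..m}" "\<lambda>k. lo + real k * \<delta>"] by simp
  finally have "real (card (threshold_grid lo hi \<delta>)) \<le> real m + 2"
    by simp
  moreover have "real m \<le> (hi - lo) / \<delta>"
    using assms by (simp add: m_def)
  ultimately show "real (card (threshold_grid lo hi \<delta>)) \<le> (hi - lo) / \<delta> + 2"
    by linarith
qed

lemma threshold_grid_endpoints:
  assumes "lo < hi"
  shows "lo \<in> threshold_grid lo hi \<delta>" "hi \<in> threshold_grid lo hi \<delta>"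
    and "threshold_grid lo hi \<delta> \<subseteq> {lo..hi}"
  using assms by (auto simp: threshold_grid_def intro!: image_eqI[of _ _ 0])

text \<open>Rounding goes upwards because the success rate is non-decreasing, so validity survives
  and only the cost grows. If the next multiple of \<open>\<delta>\<close> exceeds
  \<open>hi\<close>, the shorter last gap makes \<open>hi\<close> the witness.\<close>

lemma threshold_grid_above:
  assumes "0 < \<delta>" "\<tau> \<in> {lo..hi}"
  obtains g where "g \<in> threshold_grid lo hi \<delta>" "\<tau> \<le> g" "g \<le> \<tau> + \<delta>"
proof -
  define k where "k = nat \<lceil>(\<tau> - lo) / \<delta>\<rceil>"
  have "0 \<le> (\<tau> - lo) / \<delta>"
    using assms by simp
  then have "(\<tau> - lo) / \<delta> \<le> real k" "real k \<le> (\<tau> - lo) / \<delta> + 1"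
    unfolding k_def by linarith+
  then have k: "\<tau> \<le> lo + real k * \<delta>" "lo + real k * \<delta> \<le> \<tau> + \<delta>"
    using assms by (simp_all add: field_simps)
  show thesis
  proof (cases "lo + real k * \<delta> \<le> hi")
    case True
    with k assms that[of "lo + real k * \<delta>"] show thesis
      by (auto simp: threshold_grid_def)
  next
    case False
    with k assms that[of hi] show thesis
      by (auto simp: threshold_grid_def)
  qed
qed

section \<open>Removing the seed, and comparison with randomised benchmarks\<close>

lemma pair_prob_integral_snd:
  fixes f :: "'a \<Rightarrow> real"
  assumes "prob_space R" "prob_space M" and f: "integrable M f"
  shows "integrable (R \<Otimes>\<^sub>M M) (\<lambda>(\<omega>, x). f x)"
    and "(\<integral>z. (case z of (\<omega>, x) \<Rightarrow> f x) \<partial>(R \<Otimes>\<^sub>M M)) = (\<integral>x. f x \<partial>M)"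
proof -
  interpret R: prob_space R by fact
  interpret M: prob_space M by fact
  interpret MR: pair_prob_space M R ..
  interpret RM: pair_prob_space R M ..
  have distr: "distr (M \<Otimes>\<^sub>M R) M fst = M"
    by (rule R.distr_pair_fst)
  have f_meas: "f \<in> borel_measurable M"
    using f by simp
  have "integrable (M \<Otimes>\<^sub>M R) (\<lambda>z. f (fst z))"
    by (rule integrable_distr[OF measurable_fst]) (simp only: distr f)
  from MR.integrable_product_swap[OF this]
  show "integrable (R \<Otimes>\<^sub>M M) (\<lambda>(\<omega>, x). f x)"
    by simp
  have "(\<integral>z. f (fst z) \<partial>(M \<Otimes>\<^sub>M R)) = (\<integral>x. f x \<partial>M)"
    using integral_distr[OF measurable_fst f_meas, of R] by (simp add: distr)
  moreover have "(\<lambda>z. f (fst z)) \<in> borel_measurable (M \<Otimes>\<^sub>M R)"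
    by (rule measurable_compose[OF measurable_fst f_meas])
  ultimately show "(\<integral>z. (case z of (\<omega>, x) \<Rightarrow> f x) \<partial>(R \<Otimes>\<^sub>M M)) = (\<integral>x. f x \<partial>M)"
    using MR.integral_product_swap[of "\<lambda>z. f (fst z)"] by simp
qed

text \<open>Weak duality: the least Lagrangian value on \<open>G\<close> is, up to \<open>e\<close>,
  below the value at every \<open>\<tau>\<close>, hence below the \<open>\<nu>\<close>-average.
  There the penalty is at most 0, as \<open>\<nu>\<close> is feasible and
  \<open>l \<ge> 0\<close>.\<close>

lemma randomised_benchmark_on_finite_set:
  fixes c r :: "real \<Rightarrow> real"
  assumes \<nu>: "prob_space \<nu>" "sets \<nu> = sets (restrict_space borel A)"
    and c: "integrable \<nu> c" and r: "integrable \<nu> r" and "\<phi> \<le> (\<integral>\<tau>. r \<tau> \<partial>\<nu>)"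
    and G: "finite G" "G \<noteq> {}" and l: "0 \<le> l"
    and round: "\<And>\<tau>. \<tau> \<in> A \<Longrightarrow> \<exists>g\<in>G. c g \<le> c \<tau> + e \<and> r \<tau> \<le> r g"
  shows "\<exists>g\<in>G. c g + l * (\<phi> - r g) \<le> (\<integral>\<tau>. c \<tau> \<partial>\<nu>) + e"
proof -
  interpret \<nu>: prob_space \<nu> by fact
  have space: "space \<nu> = A"
    using sets_eq_imp_space_eq[OF \<nu>(2)] by (simp add: space_restrict_space)
  define h where "h g = c g + l * (\<phi> - r g)" for g
  define g0 where "g0 = arg_min_on h G"
  have "h g0 \<le> c \<tau> + e + l * (\<phi> - r \<tau>)" if "\<tau> \<in> A" for \<tau>
  proof -
    from round[OF that] obtain g where g: "g \<in> G" "c g \<le> c \<tau> + e" "r \<tau> \<le> r g"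
      by blast
    have "h g0 \<le> h g"
      unfolding g0_def by (rule arg_min_least[OF G g(1)])
    also have "\<dots> \<le> c \<tau> + e + l * (\<phi> - r \<tau>)"
      unfolding h_def using g l by (intro add_mono mult_left_mono) simp_all
    finally show ?thesis .
  qed
  then have "(\<integral>\<tau>. h g0 \<partial>\<nu>) \<le> (\<integral>\<tau>. c \<tau> + e + l * (\<phi> - r \<tau>) \<partial>\<nu>)"
    using c r by (intro integral_mono) (simp_all add: space)
  also have "\<dots> = (\<integral>\<tau>. c \<tau> \<partial>\<nu>) + e + l * (\<phi> - (\<integral>\<tau>. r \<tau> \<partial>\<nu>))"
    using c r by (simp add: \<nu>.prob_space)
  also have "\<dots> \<le> (\<integral>\<tau>. c \<tau> \<partial>\<nu>) + e"
    using assms(5) l by (simp add: mult_nonneg_nonpos)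
  finally have "h g0 \<le> (\<integral>\<tau>. c \<tau> \<partial>\<nu>) + e"
    by (simp add: \<nu>.prob_space)
  moreover have "g0 \<in> G"
    unfolding g0_def by (rule arg_min_if_finite(1)[OF G])
  ultimately show ?thesis
    unfolding h_def by blast
qed

lemma scalar_threshold_settingD:
  assumes "scalar_threshold_setting X Y C lo hi B" "x \<in> X"
  shows "\<tau> \<in> {lo..hi} \<Longrightarrow> 0 \<le> Y x \<tau> \<and> Y x \<tau> \<le> 1"
    and "\<tau> \<in> {lo..hi} \<Longrightarrow> 0 \<le> C x \<tau> \<and> C x \<tau> \<le> B"
    and "mono_on {lo..hi} (Y x)" and "mono_on {lo..hi} (C x)"
    and "Y x lo = 0" and "Y x hi = 1" and "C x lo = 0"
proof -
  from assms obtain \<tau>x where \<tau>x: "lo < \<tau>x" "\<tau>x < hi"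
    and Y: "\<And>\<tau>. \<tau> \<in> {lo..hi} \<Longrightarrow> \<tau> < \<tau>x \<Longrightarrow> Y x \<tau> = 0"
      "\<And>\<tau>. \<tau> \<in> {lo..hi} \<Longrightarrow> \<tau>x \<le> \<tau> \<Longrightarrow> Y x \<tau> = 1"
    unfolding scalar_threshold_setting_def greaterThanLessThan_iff Bex_def by metis
  have Y_eq: "Y x \<tau> = (if \<tau>x \<le> \<tau> then 1 else 0)" if "\<tau> \<in> {lo..hi}" for \<tau>
    using Y that by (cases "\<tau>x \<le> \<tau>") simp_all
  show "\<tau> \<in> {lo..hi} \<Longrightarrow> 0 \<le> Y x \<tau> \<and> Y x \<tau> \<le> 1"
    by (simp add: Y_eq)
  show "mono_on {lo..hi} (Y x)"
    by (rule mono_onI) (simp add: Y_eq)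
  show "Y x lo = 0" "Y x hi = 1"
    using \<tau>x by (simp_all add: Y_eq)
  show "\<tau> \<in> {lo..hi} \<Longrightarrow> 0 \<le> C x \<tau> \<and> C x \<tau> \<le> B"
    and "mono_on {lo..hi} (C x)" and "C x lo = 0"
    using assms unfolding scalar_threshold_setting_def by auto
qed

lemma mono_on_mean_value:
  assumes "prob_space D" and "\<And>\<tau>. \<tau> \<in> A \<Longrightarrow> (\<lambda>x. f x \<tau>) \<in> borel_measurable D"
    and "\<And>x \<tau>. x \<in> space D \<Longrightarrow> \<tau> \<in> A \<Longrightarrow> 0 \<le> f x \<tau> \<and> f x \<tau> \<le> b"
    and "\<And>x. x \<in> space D \<Longrightarrow> mono_on A (f x)"
  shows "mono_on A (mean_value D f)"
proof (rule mono_onI)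
  interpret prob_space D by fact
  fix \<sigma> \<tau> assume "\<sigma> \<in> A" "\<tau> \<in> A" "\<sigma> \<le> \<tau>"
  have "integrable D (\<lambda>x. f x \<upsilon>)" if "\<upsilon> \<in> A" for \<upsilon>
    using assms that by (intro integrable_const_bound[where B = b]) (auto intro!: AE_I2)
  then show "mean_value D f \<sigma> \<le> mean_value D f \<tau>"
    unfolding mean_value_def
    using \<open>\<sigma> \<in> A\<close> \<open>\<tau> \<in> A\<close> \<open>\<sigma> \<le> \<tau>\<close> assms(4) by (intro integral_mono) (auto dest: mono_onD)
qed

text \<open>Monotonicity gives both Borel measurability and a bound by the endpoint values, so the
  benchmark integrals are genuine ones and not the default value 0.\<close>

lemma integrable_mono_on:
  fixes f :: "real \<Rightarrow> real"
  assumes "prob_space \<nu>" "sets \<nu> = sets (restrict_space borel {a..b})" "mono_on {a..b} f"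
  shows "integrable \<nu> f"
proof -
  interpret prob_space \<nu> by fact
  have "space \<nu> = {a..b}"
    using sets_eq_imp_space_eq[OF assms(2)] by (simp add: space_restrict_space)
  moreover have "\<bar>f \<tau>\<bar> \<le> max \<bar>f a\<bar> \<bar>f b\<bar>" if "\<tau> \<in> {a..b}" for \<tau>
  proof -
    have "f a \<le> f \<tau>" "f \<tau> \<le> f b"
      using that by (auto intro!: mono_onD[OF assms(3)])
    then show ?thesis by linarith
  qed
  moreover have "f \<in> borel_measurable \<nu>"
    using borel_measurable_mono_on_fnc[OF assms(3)]
    by (simp cong: measurable_cong_sets add: assms(2))
  ultimately show ?thesis
    by (intro integrable_const_bound[where B = "max \<bar>f a\<bar> \<bar>f b\<bar>"]) (auto intro!: AE_I2)
qed

text \<open>A lower bound passes to a real infimum only over a nonempty set; the point mass at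
  \<open>hi\<close> is the feasible law.\<close>

lemma optimal_cost_ge:
  assumes "lo < hi" "mono_on {lo..hi} (mean_value D Y)" "\<phi> \<le> mean_value D Y hi"
    and lower: "\<And>\<nu>. prob_space \<nu> \<Longrightarrow> sets \<nu> = sets (restrict_space borel {lo..hi}) \<Longrightarrow>
      \<phi> \<le> (\<integral>\<tau>. mean_value D Y \<tau> \<partial>\<nu>) \<Longrightarrow> b \<le> (\<integral>\<tau>. mean_value D C \<tau> \<partial>\<nu>)"
  shows "b \<le> optimal_cost D Y C lo hi \<phi>"
  unfolding optimal_cost_def
proof (rule cInf_greatest)
  let ?\<nu> = "return (restrict_space borel {lo..hi}) hi"
  have hi: "hi \<in> space (restrict_space borel {lo..hi})"
    using assms(1) by (simp add: space_restrict_space)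
  then have "prob_space ?\<nu>"
    by (rule prob_space_return)
  moreover have "(\<integral>\<tau>. mean_value D Y \<tau> \<partial>?\<nu>) = mean_value D Y hi"
    by (rule integral_return[OF hi borel_measurable_mono_on_fnc[OF assms(2)]])
  ultimately show "{(\<integral>\<tau>. mean_value D C \<tau> \<partial>\<nu>) | \<nu>. prob_space \<nu> \<and>
      sets \<nu> = sets (restrict_space borel {lo..hi}) \<and> (\<integral>\<tau>. mean_value D Y \<tau> \<partial>\<nu>) \<ge> \<phi>} \<noteq> {}"
    using assms(3) by (auto intro!: exI[of _ ?\<nu>])
qed (use lower in blast)

text \<open>The choice \<open>T powr (-1/3)\<close> for both the grid width and the confidence scale
  balances exploration, of order \<open>n / \<delta>\<close>, against rounding and variance, of
  order \<open>T * \<delta>\<close>. The two logarithms come from the bonus and the harmonic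
  sum.\<close>

lemma regret_rate:
  fixes T :: nat
  assumes T: "2 \<le> T" and "0 \<le> \<Lambda>" "1 \<le> B" "0 < Q" "0 \<le> c0"
    and \<delta>: "\<delta> = real T powr (- 1 / 3)" and \<eta>: "\<eta> = 1 / sqrt (real T)" and n: "0 \<le> n" "n \<le> Q / \<delta> + 2"
  shows "real T * (c0 * \<delta>) + (1 + \<Lambda>) * (2 * (ln (real T) / \<delta> + B) * (n * (1 + ln (real T)))
      + real T * \<delta> * B\<^sup>2 + 8 * n / \<delta>) + \<eta> * real T / 2
    \<le> (4 * c0 + (1 + \<Lambda>) * (6 * (1 + 2 * B) * (Q + 2) + 4 * B\<^sup>2 + 32 * (Q + 2)) + 2)
      * ln (real T) ^ 2 * real T powr (2 / 3)"
proof -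
  \<comment> \<open>In terms of \<open>s\<close>, \<open>\<delta> = 1 / s\<close>,
    \<open>T = s^3\<close> and \<open>n \<le> (Q + 2) * s\<close>, so every term becomes a multiple
    of \<open>L^2 * s^2\<close>.\<close>
  define s where "s = real T powr (1 / 3)"
  define L where "L = ln (real T)"
  have T_pos: "0 < real T" using T by simp
  have s: "1 \<le> s"
    unfolding s_def using T by (intro ge_one_powr_ge_zero) simp_all
  have "1 / \<delta> = s"
    unfolding \<delta> s_def by (simp add: powr_minus_divide)
  then have \<delta>_eq: "\<delta> = 1 / s" "z / \<delta> = z * s" for z
    using s by (auto simp: field_simps)
  have T_eq: "real T = s ^ 3"
    unfolding s_def using T_pos by (simp add: powr_power)
  have T23: "real T powr (2 / 3) = s\<^sup>2"
    unfolding s_def using T_pos by (simp add: powr_power)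
  have T\<delta>: "real T * \<delta> = s\<^sup>2"
    unfolding T_eq \<delta>_eq(1) using s by (simp add: power2_eq_square power3_eq_cube)
  have "\<eta> * real T = sqrt (real T)"
    unfolding \<eta> using T_pos by (simp add: real_div_sqrt)
  also have "\<dots> = real T powr (1 / 2)"
    using T_pos by (simp add: powr_half_sqrt)
  also have "\<dots> \<le> real T powr (2 / 3)"
    using T by (intro powr_mono) simp_all
  finally have \<eta>T: "\<eta> * real T \<le> s\<^sup>2"
    by (simp add: T23)
  \<comment> \<open>Here \<open>T \<ge> 2\<close> enters. Constants can then be absorbed through
    \<open>1 \<le> 2 * L\<close>, \<open>1 + L \<le> 3 * L\<close> and
    \<open>1 \<le> 4 * L^2\<close>.\<close>
  have L: "1 / 2 \<le> L"
  proof -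
    have "1 / 2 \<le> ln (2::real)"
      using ln2_ge_two_thirds by linarith
    also have "\<dots> \<le> L"
      unfolding L_def using T by simp
    finally show ?thesis .
  qed
  have LL: "1 \<le> 4 * L\<^sup>2"
    using power_mono[OF L, of 2] by (simp add: power2_eq_square)
  then have sL: "s\<^sup>2 \<le> 4 * L\<^sup>2 * s\<^sup>2"
    using mult_right_mono[OF LL, of "s\<^sup>2"] by simp
  have ns: "n \<le> (Q + 2) * s"
    using n(2) s by (simp add: \<delta>_eq algebra_simps)
  have "2 * (L * s + B) * (n * (1 + L)) \<le> 2 * ((1 + 2 * B) * (L * s)) * (((Q + 2) * s) * (3 * L))"
  proof -
    have "1 * 1 \<le> (2 * L) * s"
      using L s by (intro mult_mono) simp_all
    then have "B * 1 \<le> B * (2 * L * s)"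
      using \<open>1 \<le> B\<close> by (intro mult_left_mono) simp_all
    then have "L * s + B \<le> (1 + 2 * B) * (L * s)"
      by (simp add: algebra_simps)
    moreover have "0 \<le> L * s + B"
      using L s \<open>1 \<le> B\<close> by (intro add_nonneg_nonneg mult_nonneg_nonneg) simp_all
    moreover have "n * (1 + L) \<le> ((Q + 2) * s) * (3 * L)"
      using ns n(1) L \<open>0 < Q\<close> s by (intro mult_mono) simp_all
    moreover have "0 \<le> n * (1 + L)"
      using n(1) L by simp
    ultimately show ?thesis
      by (intro mult_mono[of "2 * (L * s + B)"]) simp_all
  qed
  also have "\<dots> = 6 * (1 + 2 * B) * (Q + 2) * (L\<^sup>2 * s\<^sup>2)"
    by (simp add: power2_eq_square)
  finally have bonus: "2 * (L * s + B) * (n * (1 + L)) \<le> 6 * (1 + 2 * B) * (Q + 2) * (L\<^sup>2 * s\<^sup>2)" .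
  have variance: "s\<^sup>2 * B\<^sup>2 \<le> 4 * B\<^sup>2 * (L\<^sup>2 * s\<^sup>2)"
    using mult_right_mono[OF sL, of "B\<^sup>2"] by (simp add: algebra_simps)
  have "8 * n * s \<le> 8 * ((Q + 2) * s) * s"
    using ns s by (intro mult_right_mono mult_left_mono) simp_all
  also have "\<dots> = 8 * (Q + 2) * s\<^sup>2"
    by (simp add: power2_eq_square)
  also have "\<dots> \<le> 8 * (Q + 2) * (4 * L\<^sup>2 * s\<^sup>2)"
    using sL \<open>0 < Q\<close> by (intro mult_left_mono) simp_all
  also have "\<dots> = 32 * (Q + 2) * (L\<^sup>2 * s\<^sup>2)"
    by simp
  finally have tail: "8 * n * s \<le> 32 * (Q + 2) * (L\<^sup>2 * s\<^sup>2)" .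
  have round: "c0 * s\<^sup>2 \<le> 4 * c0 * (L\<^sup>2 * s\<^sup>2)"
    using mult_left_mono[OF sL \<open>0 \<le> c0\<close>] by (simp add: algebra_simps)
  have "(1 + \<Lambda>) * (2 * (L * s + B) * (n * (1 + L)) + s\<^sup>2 * B\<^sup>2 + 8 * n * s)
      \<le> (1 + \<Lambda>) * (6 * (1 + 2 * B) * (Q + 2) * (L\<^sup>2 * s\<^sup>2) + 4 * B\<^sup>2 * (L\<^sup>2 * s\<^sup>2) + 32 * (Q + 2) * (L\<^sup>2 * s\<^sup>2))"
    using bonus variance tail \<open>0 \<le> \<Lambda>\<close> by (intro mult_left_mono add_mono) simp_all
  also have "\<dots> = (1 + \<Lambda>) * (6 * (1 + 2 * B) * (Q + 2) + 4 * B\<^sup>2 + 32 * (Q + 2)) * (L\<^sup>2 * s\<^sup>2)"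
    by (simp only: ring_distribs mult.assoc)
  finally have "c0 * s\<^sup>2 + (1 + \<Lambda>) * (2 * (L * s + B) * (n * (1 + L)) + s\<^sup>2 * B\<^sup>2 + 8 * n * s) + \<eta> * real T / 2
      \<le> 4 * c0 * (L\<^sup>2 * s\<^sup>2) + (1 + \<Lambda>) * (6 * (1 + 2 * B) * (Q + 2) + 4 * B\<^sup>2 + 32 * (Q + 2)) * (L\<^sup>2 * s\<^sup>2)
        + 2 * (L\<^sup>2 * s\<^sup>2)"
    using round \<eta>T sL by linarith
  also have "\<dots> = (4 * c0 + (1 + \<Lambda>) * (6 * (1 + 2 * B) * (Q + 2) + 4 * B\<^sup>2 + 32 * (Q + 2)) + 2) * L\<^sup>2 * s\<^sup>2"
    by algebra
  finally have main: "c0 * s\<^sup>2 + (1 + \<Lambda>) * (2 * (L * s + B) * (n * (1 + L)) + s\<^sup>2 * B\<^sup>2 + 8 * n * s) + \<eta> * real T / 2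
      \<le> (4 * c0 + (1 + \<Lambda>) * (6 * (1 + 2 * B) * (Q + 2) + 4 * B\<^sup>2 + 32 * (Q + 2)) + 2) * L\<^sup>2 * s\<^sup>2" .
  have "real T * (c0 * \<delta>) = c0 * s\<^sup>2"
    using T\<delta> by (simp add: mult.left_commute)
  then show ?thesis
    unfolding L_def[symmetric] \<delta>_eq(2) T\<delta> T23 by (simp only: main)
qed

section \<open>Assembly of grid, policy, validity and efficiency\<close>

theorem corollary1:
  "\<exists>(A::real) (B::real) (K :: real \<Rightarrow> real \<Rightarrow> real \<Rightarrow> real \<Rightarrow> real) (p::nat).
   \<forall>(T::nat) (\<phi>::real) (\<tau>min::real) (\<tau>max::real) (Cmax::real).
     2 \<le> T \<and> 0 < \<phi> \<and> \<phi> < 1 \<and> \<tau>min < \<tau>max \<and> 1 \<le> Cmax \<longrightarrow>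
     (let Q = \<tau>max - \<tau>min;
          \<delta> = real T powr (- 1 / 3);
          G = threshold_grid \<tau>min \<tau>max \<delta>;
          n = card G;
          \<Lambda> = Cmax / (1 - \<phi>);
          \<eta> = 1 / sqrt (real T)
      in finite G \<and> real n \<le> A * (Q / \<delta>) + B \<and>
         (\<exists>R \<alpha>. bandit_policy R \<alpha> \<and>
            (\<forall>\<omega>\<in>space R. \<forall>h. \<alpha> \<omega> h \<in> G) \<and>
            (\<forall>(X :: 'x set) Y C. scalar_threshold_setting X Y C \<tau>min \<tau>max Cmax \<longrightarrow>
               (\<forall>\<omega>\<in>space R. \<forall>x. (\<forall>t\<in>{1..T}. x t \<in> X) \<longrightarrow>
                  (\<forall>l L. 1 \<le> L \<and> {l..l + L - 1} \<subseteq> {n - 1..T} \<longrightarrow>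
                     \<bar>(\<Sum>t=l..l + L - 1. Y (x t) (chosen_threshold (\<alpha> \<omega>) Y C x t)) / real L - \<phi>\<bar>
                       \<le> (\<Lambda> + 2 * \<eta>) / (\<eta> * real L))) \<and>
               (\<forall>D c0. prob_space D \<and> space D = X \<and>
                  (\<forall>\<tau>\<in>{\<tau>min..\<tau>max}. (\<lambda>x. Y x \<tau>) \<in> borel_measurable D \<and>
                                   (\<lambda>x. C x \<tau>) \<in> borel_measurable D) \<and>
                  c0-lipschitz_on {\<tau>min..\<tau>max} (mean_value D C) \<longrightarrow>
                  (let P = R \<Otimes>\<^sub>M (\<Pi>\<^sub>M t\<in>{1..T}. D);
                       regret = (\<lambda>(\<omega>, x). \<Sum>t=1..T.
                          (C (x t) (chosen_threshold (\<alpha> \<omega>) Y C x t)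
                            - optimal_cost D Y C \<tau>min \<tau>max \<phi>))
                   in integrable P regret \<and>
                      (\<integral>z. regret z \<partial>P)
                        \<le> K Q \<phi> Cmax c0 * ln (real T) ^ p * real T powr (2 / 3))))))"
proof -
  \<comment> \<open>This is the constant of \<open>regret_rate\<close> with \<open>\<Lambda>\<close>
    written out, so it depends only on the width, \<open>\<phi>\<close>, the cost cap and
    \<open>c0\<close>.\<close>
  define K where "K Q \<phi> B c0 = 4 * c0 + (1 + B / (1 - \<phi>)) *
    (6 * (1 + 2 * B) * (Q + 2) + 4 * B\<^sup>2 + 32 * (Q + 2)) + 2" for Q \<phi> B c0 :: real
  show ?thesis
  proof (rule exI[of _ 1], rule exI[of _ 2], rule exI[of _ K], rule exI[of _ 2],
      intro allI impI, elim conjE, goal_cases)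
    case (1 T \<phi> lo hi B)
    note T2 = 1(1) and \<phi> = 1(2,3) and lo_hi = 1(4) and B = 1(5)
    define \<delta> where "\<delta> = real T powr (- 1 / 3)"
    define G where "G = threshold_grid lo hi \<delta>"
    define \<Lambda> where "\<Lambda> = B / (1 - \<phi>)"
    define \<eta> where "\<eta> = 1 / sqrt (real T)"
    define \<beta> where "\<beta> = ln (real T) / \<delta> + B"
    have \<delta>: "0 < \<delta>" and \<eta>: "0 < \<eta>" and \<Lambda>: "0 \<le> \<Lambda>"
      using T2 \<phi> B by (simp_all add: \<delta>_def \<eta>_def \<Lambda>_def)
    note card_G = threshold_grid_card[OF \<delta> lo_hi, folded G_def]
    note ends = threshold_grid_endpoints[OF lo_hi, of \<delta>, folded G_def]
    interpret primal_dual_lcb G lo hi \<phi> \<eta> \<Lambda> \<beta>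
      by unfold_locales (use card_G ends in auto)
    define R where "R = return borel (0::real)"
    have R: "prob_space R"
      unfolding R_def by (rule prob_space_return) simp
    \<comment> \<open>Both endpoints are grid points, so \<open>card G - 1 \<ge> 1\<close> and every
      admissible window starts at step 1 or later.\<close>
    have "2 \<le> card G"
      using card_mono[OF card_G(1), of "{lo, hi}"] ends lo_hi by simp
    have environment: "lcb_environment G lo hi \<phi> \<eta> \<Lambda> X Y C B"
      if setting: "scalar_threshold_setting X Y C lo hi B" for X :: "'x set" and Y C
      by unfold_locales
        (use \<phi> \<eta> B ends(3) scalar_threshold_settingD[OF setting] in \<open>auto simp: \<Lambda>_def\<close>)
    have validity: "\<bar>(\<Sum>t=l..l + L - 1. Y (x t) (chosen_threshold policy Y C x t)) / real L - \<phi>\<bar>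
        \<le> (\<Lambda> + 2 * \<eta>) / (\<eta> * real L)"
      if setting: "scalar_threshold_setting X Y C lo hi B" and x: "\<forall>t\<in>{1..T}. x t \<in> X"
        and L: "1 \<le> L" and window: "{l..l + L - 1} \<subseteq> {card G - 1..T}"
      for X :: "'x set" and Y C x l L
    proof -
      interpret lcb_environment G lo hi \<phi> \<eta> \<Lambda> \<beta> X Y C B
        by (rule environment[OF setting])
      have "l \<in> {card G - 1..T}" "l + L - 1 \<in> {card G - 1..T}"
        using window L by auto
      with \<open>2 \<le> card G\<close> have "1 \<le> l" "l + L - 1 \<le> T"
        by auto
      then show ?thesis
        using x L by (intro window_validity) auto
    qed
    have efficiency: "integrable (R \<Otimes>\<^sub>M (\<Pi>\<^sub>M t\<in>{1..T}. D)) (\<lambda>(\<omega>, x). \<Sum>t=1..T.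
          (C (x t) (chosen_threshold policy Y C x t) - optimal_cost D Y C lo hi \<phi>))"
        "(\<integral>z. (case z of (\<omega>, x) \<Rightarrow> \<Sum>t=1..T.
          (C (x t) (chosen_threshold policy Y C x t) - optimal_cost D Y C lo hi \<phi>))
            \<partial>(R \<Otimes>\<^sub>M (\<Pi>\<^sub>M t\<in>{1..T}. D)))
          \<le> K (hi - lo) \<phi> B c0 * ln (real T) ^ 2 * real T powr (2 / 3)"
      if setting: "scalar_threshold_setting X Y C lo hi B" and D: "prob_space D" "space D = X"
        and meas: "\<forall>\<tau>\<in>{lo..hi}. (\<lambda>x. Y x \<tau>) \<in> borel_measurable D \<and> (\<lambda>x. C x \<tau>) \<in> borel_measurable D"
        and lipschitz: "c0-lipschitz_on {lo..hi} (mean_value D C)"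
      for X :: "'x set" and Y C D c0
    proof -
      interpret env: lcb_environment G lo hi \<phi> \<eta> \<Lambda> \<beta> X Y C B
        by (rule environment[OF setting])
      interpret D: prob_space D by fact
      \<comment> \<open>The grid width also serves as the confidence scale
        \<open>\<theta>\<close>.\<close>
      interpret lcb_stochastic G lo hi \<phi> \<eta> \<Lambda> \<beta> X Y C B D T \<delta>
        by unfold_locales (use D T2 \<delta> meas ends(3) in \<open>auto simp: \<beta>_def\<close>)
      note settingD = scalar_threshold_settingD[OF setting]
      have c_mono: "mono_on {lo..hi} (mean_value D C)"
        by (rule mono_on_mean_value[OF D(1), where b = B]) (use D meas settingD in auto)
      have r_mono: "mono_on {lo..hi} (mean_value D Y)"
        by (rule mono_on_mean_value[OF D(1), where b = 1]) (use D meas settingD in auto)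
      have "mean_value D Y hi = (\<integral>x. 1 \<partial>D)"
        unfolding mean_value_def
        by (rule Bochner_Integration.integral_cong) (simp_all add: D(2) settingD)
      then have r_hi: "\<phi> \<le> mean_value D Y hi"
        using \<phi> by (simp add: D.prob_space)
      have round: "\<exists>g\<in>G. mean_value D C g \<le> mean_value D C \<tau> + c0 * \<delta> \<and> mean_value D Y \<tau> \<le> mean_value D Y g"
        if \<tau>: "\<tau> \<in> {lo..hi}" for \<tau>
      proof -
        from threshold_grid_above[OF \<delta> \<tau>] obtain g where g: "g \<in> G" "\<tau> \<le> g" "g \<le> \<tau> + \<delta>"
          unfolding G_def by blast
        then have g_in: "g \<in> {lo..hi}"
          using ends(3) by blast
        have "\<bar>mean_value D C g - mean_value D C \<tau>\<bar> \<le> c0 * \<bar>g - \<tau>\<bar>"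
          using lipschitz_onD[OF lipschitz g_in \<tau>] by (simp add: dist_real_def)
        also have "\<dots> \<le> c0 * \<delta>"
          using g lipschitz_on_nonneg[OF lipschitz] by (intro mult_left_mono) simp_all
        finally have "mean_value D C g \<le> mean_value D C \<tau> + c0 * \<delta>"
          by linarith
        with g mono_onD[OF r_mono \<tau> g_in] show ?thesis by blast
      qed
      define E where "E = K (hi - lo) \<phi> B c0 * ln (real T) ^ 2 * real T powr (2 / 3)"
      define cost where "cost x = (\<Sum>t<T. C (x (Suc t)) (env.arm x t))" for x
      have cost_int: "integrable contexts cost"
        unfolding cost_def by (rule Bochner_Integration.integrable_sum) (rule integrable_cost, simp)
      have cost_le: "(\<integral>x. cost x \<partial>contexts) \<le> real T * (\<integral>\<tau>. mean_value D C \<tau> \<partial>\<nu>) + E"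
        if \<nu>: "prob_space \<nu>" "sets \<nu> = sets (restrict_space borel {lo..hi})"
          and feasible: "\<phi> \<le> (\<integral>\<tau>. mean_value D Y \<tau> \<partial>\<nu>)" for \<nu>
      proof -
        let ?V = "\<integral>\<tau>. mean_value D C \<tau> \<partial>\<nu>"
        have "space \<nu> = {lo..hi}"
          using sets_eq_imp_space_eq[OF \<nu>(2)] by (simp add: space_restrict_space)
        moreover have "0 \<le> mean_value D C \<tau>" if "\<tau> \<in> {lo..hi}" for \<tau>
          unfolding mean_value_def
          by (rule Bochner_Integration.integral_nonneg) (use settingD that D(2) in auto)
        ultimately have "0 \<le> ?V"
          by (intro Bochner_Integration.integral_nonneg) simp
        moreover have "0 \<le> c0 * \<delta>"
          using \<delta> lipschitz_on_nonneg[OF lipschitz] by simp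
        moreover have "\<exists>g\<in>G. lagrangian l g \<le> ?V + c0 * \<delta>" if "0 \<le> l" for l
          unfolding lagrangian_def
          by (rule randomised_benchmark_on_finite_set[OF \<nu> integrable_mono_on[OF \<nu> c_mono]
              integrable_mono_on[OF \<nu> r_mono] feasible card_G(1) G_nonempty that round])
        ultimately have "(\<integral>x. cost x \<partial>contexts) \<le> real T * (?V + c0 * \<delta>)
            + (1 + \<Lambda>) * (2 * \<beta> * (real (card G) * (1 + ln (real T))) + real T * \<delta> * B\<^sup>2
              + 8 * real (card G) / \<delta>) + \<eta> * real T / 2"
          unfolding cost_def by (intro expected_cost_le) simp_all
        also have "\<dots> \<le> real T * ?V + E"
          using regret_rate[OF T2 \<Lambda> B _ lipschitz_on_nonneg[OF lipschitz] \<delta>_def \<eta>_def _ card_G(2)] lo_hi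
          unfolding E_def K_def \<Lambda>_def[symmetric] \<beta>_def by (simp add: distrib_left)
        finally show ?thesis .
      qed
      \<comment> \<open>Attainment of the infimum is avoided: \<open>cost_le\<close> is read as a
        lower bound on the value of each feasible \<open>\<nu>\<close>, which passes to the
        infimum.\<close>
      have "((\<integral>x. cost x \<partial>contexts) - E) / real T \<le> optimal_cost D Y C lo hi \<phi>"
      proof (rule optimal_cost_ge[OF lo_hi r_mono r_hi])
        fix \<nu> assume "prob_space \<nu>" "sets \<nu> = sets (restrict_space borel {lo..hi})"
          "\<phi> \<le> (\<integral>\<tau>. mean_value D Y \<tau> \<partial>\<nu>)"
        from cost_le[OF this] show "((\<integral>x. cost x \<partial>contexts) - E) / real T \<le> (\<integral>\<tau>. mean_value D C \<tau> \<partial>\<nu>)"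
          using T2 by (simp add: pos_divide_le_eq mult.commute)
      qed
      then have "(\<integral>x. cost x \<partial>contexts) - real T * optimal_cost D Y C lo hi \<phi> \<le> E"
        using T2 by (simp add: pos_divide_le_eq mult.commute)
      moreover have regret_eq: "(\<Sum>t=1..T. (C (x t) (chosen_threshold policy Y C x t)
          - optimal_cost D Y C lo hi \<phi>)) = cost x - real T * optimal_cost D Y C lo hi \<phi>" for x
        by (simp add: sum.atLeast1_atMost_eq env.chosen_threshold_eq cost_def sum_subtractf)
      moreover have int: "integrable contexts (\<lambda>x. cost x - real T * optimal_cost D Y C lo hi \<phi>)"
        by (rule Bochner_Integration.integrable_diff[OF cost_int N.integrable_const])
      ultimately show "integrable (R \<Otimes>\<^sub>M (\<Pi>\<^sub>M t\<in>{1..T}. D)) (\<lambda>(\<omega>, x). \<Sum>t=1..T.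
          (C (x t) (chosen_threshold policy Y C x t) - optimal_cost D Y C lo hi \<phi>))"
        and "(\<integral>z. (case z of (\<omega>, x) \<Rightarrow> \<Sum>t=1..T.
          (C (x t) (chosen_threshold policy Y C x t) - optimal_cost D Y C lo hi \<phi>))
            \<partial>(R \<Otimes>\<^sub>M (\<Pi>\<^sub>M t\<in>{1..T}. D)))
          \<le> K (hi - lo) \<phi> B c0 * ln (real T) ^ 2 * real T powr (2 / 3)"
        unfolding regret_eq E_def[symmetric] pair_prob_integral_snd(2)[OF R N.prob_space_axioms int]
        using pair_prob_integral_snd(1)[OF R N.prob_space_axioms int] cost_int
        by (simp_all add: N.prob_space del: One_nat_def)
    qed
    have "bandit_policy R (\<lambda>_. policy)"
      unfolding R_def by (rule bandit_policy)
    then show ?case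
      unfolding Let_def \<delta>_def[symmetric] G_def[symmetric] \<Lambda>_def[symmetric] \<eta>_def[symmetric]
      using card_G policy_in_G validity efficiency
      by (intro conjI exI[of _ R] exI[of _ "\<lambda>_. policy"] allI impI ballI) (simp_all only: mult_1, blast+)
  qed
qed

end
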